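(* Let $H:\mathbb C^+\to\mathbb C$ be an analytic function such that $\Im H(z)\le\Im z$ for $z\in\mathbb C^+$, and such that the limit $a=\lim_{y\to+\infty}\frac{H(iy)}{iy}$ is strictly positive. Then: (1) For every $\alpha\in\mathbb C^+$ there exists a unique $z\in\mathbb C^+$ such that $H(z)=\alpha$. (2) There exists a continuous function $\omega:\mathbb C^+\cup\mathbb R\to\mathbb C^+\cup\mathbb R$ such that $\omega(\mathbb C^+)\subset\mathbb C^+$, $\omega|_{\mathbb C^+}$ is analytic, and $H(\omega(z))=z$ for $z\in\mathbb C^+$. (3) For each $\alpha\in\mathbb C^+\cup\mathbb R$, $\omega(\alpha)$ is the Denjoy-Wolff point of the map $g_\alpha:\mathbb C^+\to\mathbb C^+\cup\mathbb R$ defined by $g_\alpha(z)=z+\alpha-H(z)$, $z\in\mathbb C^+$. (4) The function $\omega$ satisfies $\Re\omega'(z)>1/2$ for $z\in\mathbb C^+$, and $|\omega(z_1)-\omega(z_2)|\ge\frac12|z_1-z_2|$ for $z_1,z_2\in\mathbb C^+\cup\mathbb R$. In particular, $\omega$ is one-to-one. (5) If $\alpha\in\mathbb R$ is such that $\Im\omega(\alpha)>0$, then $\omega$ can be continued analytically to a neighborhood of $\alpha$.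
   Context: $\mathbb C^+=\{z\in\mathbb C:\Im z>0\}$. Denjoy-Wolff points: for an analytic $f:\mathbb D\to\overline{\mathbb D}$ on the unit disk, $w\in\overline{\mathbb D}$ is a Denjoy-Wolff point if either $|w|<1$ and $f(w)=w$, or $|w|=1$, the nontangential limit of $f$ at $w$ equals $w$, and the nontangential limit of $\frac{f(z)-w}{z-w}$ as $z\to w$ exists and is $\le1$. Every such $f$ other than the identity has exactly one Denjoy-Wolff point. The notion is transported to analytic maps $\mathbb C^+\to\overline{\mathbb C^+}\cup\{\infty\}$ by a conformal map of $\mathbb C^+$ onto $\mathbb D$; at the boundary point $\infty$ the derivative condition reads $\lim z/f(z)\le1$ as $z\to\infty$ nontangentially. *)

theory Defs
  imports "HOL-Complex_Analysis.Complex_Analysis"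
begin

definition upper_halfplane :: "complex set" where
  "upper_halfplane = {z. Im z > 0}"

definition closed_upper_halfplane :: "complex set" where
  "closed_upper_halfplane = {z. Im z \<ge> 0}"

text \<open>Nontangential approach regions in the unit disk. For \<open>M > 1\<close> the region at a point
  \<open>w\<close> of the unit circle contains the radius ending at \<open>w\<close>, so \<open>w\<close> is a limit point of it.\<close>

definition stolz_region :: "complex \<Rightarrow> real \<Rightarrow> complex set" where
  "stolz_region w M = {z \<in> ball 0 1. norm (z - w) < M * (1 - norm z)}"

definition has_nontangential_limit :: "(complex \<Rightarrow> complex) \<Rightarrow> complex \<Rightarrow> complex \<Rightarrow> bool" where
  "has_nontangential_limit f w l \<longleftrightarrow> (\<forall>M>1. (f \<longlongrightarrow> l) (at w within stolz_region w M))"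

definition denjoy_wolff_point :: "(complex \<Rightarrow> complex) \<Rightarrow> complex \<Rightarrow> bool" where
  "denjoy_wolff_point f w \<longleftrightarrow>
     f holomorphic_on ball 0 1 \<and> f ` ball 0 1 \<subseteq> cball 0 1 \<and>
     (norm w < 1 \<and> f w = w \<or>
      norm w = 1 \<and> has_nontangential_limit f w w \<and>
      (\<exists>c::real. c \<le> 1 \<and>
         has_nontangential_limit (\<lambda>z. (f z - w) / (z - w)) w (of_real c)))"

text \<open>The Cayley transform maps the upper half-plane conformally onto the unit disk and extends to
  the closed half-plane together with \<open>\<infinity>\<close>, the point \<open>\<infinity>\<close> going to \<open>1\<close>.\<close>

definition cayley :: "complex \<Rightarrow> complex" where
  "cayley z = (z - \<i>) / (z + \<i>)"

definition inv_cayley :: "complex \<Rightarrow> complex" where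
  "inv_cayley u = \<i> * (1 + u) / (1 - u)"

lemma inv_cayley_cayley: "z \<in> closed_upper_halfplane \<Longrightarrow> inv_cayley (cayley z) = z"
proof -
  assume "z \<in> closed_upper_halfplane"
  then have "z + \<i> \<noteq> 0"
    by (auto simp: closed_upper_halfplane_def complex_eq_iff)
  then show ?thesis
    by (simp add: cayley_def inv_cayley_def divide_simps)
qed

lemma cayley_inv_cayley: "u \<noteq> 1 \<Longrightarrow> cayley (inv_cayley u) = u"
  by (simp add: cayley_def inv_cayley_def divide_simps) (simp add: algebra_simps)

lemma bij_betw_cayley: "bij_betw cayley upper_halfplane (ball 0 1)"
proof (rule bij_betw_byWitness[where f' = inv_cayley])
  show "\<forall>z\<in>upper_halfplane. inv_cayley (cayley z) = z"
    by (auto intro!: inv_cayley_cayley simp: upper_halfplane_def closed_upper_halfplane_def)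
  show "\<forall>u\<in>ball 0 1. cayley (inv_cayley u) = u"
    by (auto intro!: cayley_inv_cayley)
  show "cayley ` upper_halfplane \<subseteq> ball 0 1"
  proof clarify
    fix z assume "z \<in> upper_halfplane"
    then have z: "Im z > 0" by (simp add: upper_halfplane_def)
    have "(norm (z - \<i>))\<^sup>2 < (norm (z + \<i>))\<^sup>2"
      using z unfolding cmod_power2 by (simp add: power2_eq_square algebra_simps)
    then have "norm (z - \<i>) < norm (z + \<i>)"
      by (rule power2_less_imp_less) simp
    then show "cayley z \<in> ball 0 1"
      by (simp add: cayley_def norm_divide divide_simps)
  qed
  show "inv_cayley ` ball 0 1 \<subseteq> upper_halfplane"
  proof clarify
    fix u :: complex assume "u \<in> ball 0 1"
    then have u: "norm u < 1" by simp
    then have "(norm u)\<^sup>2 < 1" by (simp add: power_less_one_iff abs_square_less_1)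
    then have 1: "1 - (Re u)\<^sup>2 - (Im u)\<^sup>2 > 0" by (simp add: cmod_power2)
    have 2: "(Re (1 - u))\<^sup>2 + (Im (1 - u))\<^sup>2 > 0"
      using 1 by (auto simp: sum_power2_gt_zero_iff)
    have "Im (inv_cayley u) = (1 - (Re u)\<^sup>2 - (Im u)\<^sup>2) / ((Re (1 - u))\<^sup>2 + (Im (1 - u))\<^sup>2)"
      unfolding inv_cayley_def Im_divide by (simp add: power2_eq_square algebra_simps)
    then show "inv_cayley u \<in> upper_halfplane"
      using 1 2 by (simp add: upper_halfplane_def)
  qed
qed

text \<open>\<open>w\<close> is the unique Denjoy-Wolff point of the self-map \<open>f\<close> of the half-plane, transported to
  the disk. The competitors \<open>v\<close> range over the whole closed disk; \<open>v = 1\<close> is the point \<open>\<infinity>\<close>.\<close>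

definition is_the_denjoy_wolff_point_uhp :: "(complex \<Rightarrow> complex) \<Rightarrow> complex \<Rightarrow> bool" where
  "is_the_denjoy_wolff_point_uhp f w \<longleftrightarrow>
     f holomorphic_on upper_halfplane \<and> f ` upper_halfplane \<subseteq> closed_upper_halfplane \<and>
     w \<in> closed_upper_halfplane \<and>
     (\<forall>v. denjoy_wolff_point (cayley \<circ> f \<circ> inv_cayley) v \<longleftrightarrow> v = cayley w)"

end

theory Submission
  imports Defs
begin

text \<open>Write \<open>g z = z + \<alpha> - H z\<close>, so that \<open>H z = \<alpha>\<close> means \<open>g z = z\<close>. Call \<open>w\<close> in the closed
  half-plane a Julia point of \<open>g\<close> if \<open>|g z - w|^2 Im z \<le> |z - w|^2 Im (g z)\<close> for all \<open>z\<close>. Inside the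
  half-plane these are the fixed points (Schwarz-Pick), and on the real line they are the
  Denjoy-Wolff points (Julia-Caratheodory). Two distinct Julia points would force \<open>g\<close> to fix the
  whole geodesic between them, hence to be the identity, so there is at most one. For \<open>Im \<alpha> > 0\<close> a
  fixed point exists by Brouwer's theorem. Since \<open>Im H(iy)\<close> is unbounded, Julia points stay bounded
  while \<open>\<alpha>\<close> does, and the condition is closed in \<open>(\<alpha>, w)\<close>; so for every \<open>\<alpha>\<close> in the closed half-plane
  there is exactly one, \<open>\<omega>(\<alpha>)\<close>, and it depends continuously on \<open>\<alpha>\<close>. Schwarz-Pick for \<open>z - H z\<close> at
  two values of \<open>\<omega>\<close> reads \<open>|\<Delta>\<omega> - \<Delta>\<alpha>| \<le> |\<Delta>\<omega>|\<close>, which gives \<open>|\<Delta>\<alpha>| \<le> 2 |\<Delta>\<omega>|\<close> and \<open>Re \<omega>' > 1/2\<close>.\<close>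

subsection \<open>The Schwarz-Pick inequality in the half-plane\<close>

lemma open_upper_halfplane: "open upper_halfplane"
  by (simp add: upper_halfplane_def open_halfspace_Im_gt)

text \<open>Allows the pseudo-hyperbolic distance \<open>|z - p| / |z - cnj p|\<close> to be
  compared without division, in terms of \<open>|z - p|^2\<close> and imaginary parts only.\<close>

lemma norm_diff_cnj_power2:
  "(cmod (z - cnj p))\<^sup>2 = (cmod (z - p))\<^sup>2 + 4 * Im z * Im p"
  unfolding cmod_power2 by (simp add: power2_eq_square algebra_simps)

lemma norm_halfplane_quotient_less_one:
  assumes "Im z > 0" "Im p > 0"
  shows "cmod ((z - p) / (z - cnj p)) < 1"
proof -
  have "(cmod (z - p))\<^sup>2 < (cmod (z - cnj p))\<^sup>2"
    using assms by (simp add: norm_diff_cnj_power2)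
  then have "cmod (z - p) < cmod (z - cnj p)"
    by (rule power2_less_imp_less) simp
  then show ?thesis
    by (simp add: norm_divide divide_less_eq_1)
qed

text \<open>This formula is the conformal map of the disk onto the half-plane that sends 0 to
  \<open>p\<close>, inverse to \<open>(z - p) / (z - cnj p)\<close>.\<close>

lemma Im_halfplane_quotient_inverse:
  assumes "norm u < 1" "Im p > 0"
  shows "Im ((p - cnj p * u) / (1 - u)) > 0"
proof -
  have "(norm u)\<^sup>2 < 1"
    using assms by (simp add: abs_square_less_1)
  then have 1: "1 - (Re u)\<^sup>2 - (Im u)\<^sup>2 > 0"
    by (simp add: cmod_power2)
  have "(1 - Re u)\<^sup>2 + (Im u)\<^sup>2 > 0"
    using 1 by (auto simp: sum_power2_gt_zero_iff)
  moreover have "Im ((p - cnj p * u) / (1 - u)) =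
      Im p * (1 - (Re u)\<^sup>2 - (Im u)\<^sup>2) / ((1 - Re u)\<^sup>2 + (Im u)\<^sup>2)"
    unfolding Im_divide by (simp add: power2_eq_square algebra_simps)
  ultimately show ?thesis
    using 1 assms by simp
qed

lemma halfplane_quotient_inverse:
  assumes "Im z > 0" "Im p > 0"
  defines "u \<equiv> (z - p) / (z - cnj p)"
  shows "(p - cnj p * u) / (1 - u) = z"
proof -
  have nz: "z - cnj p \<noteq> 0" "p - cnj p \<noteq> 0"
    using assms by (auto simp: complex_eq_iff)
  have "1 - u = (p - cnj p) / (z - cnj p)" "p - cnj p * u = z * (p - cnj p) / (z - cnj p)"
    using nz by (simp_all add: u_def field_simps)
  then show ?thesis
    using nz by simp
qed

text \<open>The source is centred at \<open>p\<close> and the target at \<open>g p\<close>, so the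
  Schwarz lemma becomes applicable without \<open>p\<close> being fixed. Strict positivity keeps the
  values inside the open disk.\<close>

lemma schwarz_conjugate:
  fixes g :: "complex \<Rightarrow> complex"
  assumes holg: "g holomorphic_on upper_halfplane"
    and pos: "\<And>z. Im z > 0 \<Longrightarrow> Im (g z) > 0"
    and p: "Im p > 0"
  defines "f \<equiv> \<lambda>u. (g ((p - cnj p * u) / (1 - u)) - g p) / (g ((p - cnj p * u) / (1 - u)) - cnj (g p))"
  shows "f holomorphic_on ball 0 1" "f 0 = 0" "\<And>u. norm u < 1 \<Longrightarrow> norm (f u) < 1"
proof -
  have ne: "1 - u \<noteq> 0" if "norm u < 1" for u :: complex
    using that by auto
  have in_uhp: "Im ((p - cnj p * u) / (1 - u)) > 0" if "norm u < 1" for u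
    using Im_halfplane_quotient_inverse that p by blast
  have "(g \<circ> (\<lambda>u. (p - cnj p * u) / (1 - u))) holomorphic_on ball 0 1"
  proof (rule holomorphic_on_compose_gen[OF _ holg])
    show "(\<lambda>u. (p - cnj p * u) / (1 - u)) holomorphic_on ball 0 1"
      using ne by (intro holomorphic_intros) auto
    show "(\<lambda>u. (p - cnj p * u) / (1 - u)) ` ball 0 1 \<subseteq> upper_halfplane"
      using in_uhp by (auto simp: upper_halfplane_def)
  qed
  then have hol: "(\<lambda>u. g ((p - cnj p * u) / (1 - u))) holomorphic_on ball 0 1"
    by (simp add: o_def)
  have "g ((p - cnj p * u) / (1 - u)) - cnj (g p) \<noteq> 0" if "norm u < 1" for u
    using pos[OF in_uhp[OF that]] pos[OF p] by (auto simp: complex_eq_iff)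
  then show "f holomorphic_on ball 0 1"
    unfolding f_def using hol by (intro holomorphic_intros) auto
  show "f 0 = 0"
    by (simp add: f_def)
  show "norm (f u) < 1" if "norm u < 1" for u
    unfolding f_def using norm_halfplane_quotient_less_one pos[OF in_uhp[OF that]] pos[OF p] by blast
qed

text \<open>The Schwarz bound \<open>norm (f u) \<le> norm u\<close>, squared and cleared of
  denominators; the common term \<open>|g z - g p|^2 |z - p|^2\<close> cancels.\<close>

lemma schwarz_pick_open:
  fixes g :: "complex \<Rightarrow> complex"
  assumes holg: "g holomorphic_on upper_halfplane"
    and pos: "\<And>z. Im z > 0 \<Longrightarrow> Im (g z) > 0"
    and z: "Im z > 0" and p: "Im p > 0"
  shows "(cmod (g z - g p))\<^sup>2 * Im z * Im p \<le> (cmod (z - p))\<^sup>2 * Im (g z) * Im (g p)"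
proof -
  define f where "f = (\<lambda>u. (g ((p - cnj p * u) / (1 - u)) - g p) / (g ((p - cnj p * u) / (1 - u)) - cnj (g p)))"
  define u where "u = (z - p) / (z - cnj p)"
  have sc: "f holomorphic_on ball 0 1" "f 0 = 0" "\<And>u. norm u < 1 \<Longrightarrow> norm (f u) < 1"
    unfolding f_def by (rule schwarz_conjugate[OF holg _ p]; simp add: pos)+
  have "norm u < 1"
    unfolding u_def using norm_halfplane_quotient_less_one z p .
  then have "norm (f u) \<le> norm u"
    using Schwarz_Lemma(1)[OF sc(1,2)] sc(3) by blast
  moreover have "f u = (g z - g p) / (g z - cnj (g p))"
    using halfplane_quotient_inverse[OF z p] by (simp add: f_def u_def)
  ultimately have "norm ((g z - g p) / (g z - cnj (g p))) \<le> norm ((z - p) / (z - cnj p))"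
    by (simp add: u_def)
  moreover have "z - cnj p \<noteq> 0" "g z - cnj (g p) \<noteq> 0"
    using z p pos[OF z] pos[OF p] by (auto simp: complex_eq_iff)
  ultimately have "cmod (g z - g p) * cmod (z - cnj p) \<le> cmod (z - p) * cmod (g z - cnj (g p))"
    by (simp add: norm_divide field_simps)
  then have "(cmod (g z - g p) * cmod (z - cnj p))\<^sup>2 \<le> (cmod (z - p) * cmod (g z - cnj (g p)))\<^sup>2"
    by (rule power_mono) simp
  then show ?thesis
    unfolding power_mult_distrib norm_diff_cnj_power2 by (simp add: algebra_simps)
qed

lemma schwarz_pick:
  fixes g :: "complex \<Rightarrow> complex"
  assumes holg: "g holomorphic_on upper_halfplane"
    and nonneg: "\<And>z. Im z > 0 \<Longrightarrow> Im (g z) \<ge> 0"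
    and z: "Im z > 0" and p: "Im p > 0"
  shows "(cmod (g z - g p))\<^sup>2 * Im z * Im p \<le> (cmod (z - p))\<^sup>2 * Im (g z) * Im (g p)"
proof -
  have "(cmod (g z - g p))\<^sup>2 * Im z * Im p \<le> (cmod (z - p))\<^sup>2 * (Im (g z) + e) * (Im (g p) + e)"
    if "e > 0" for e
  proof -
    have "(\<lambda>z. g z + \<i> * of_real e) holomorphic_on upper_halfplane"
      by (intro holomorphic_intros holg)
    from schwarz_pick_open[OF this _ z p] show ?thesis
      using nonneg that by (auto simp: add_nonneg_pos)
  qed
  then have "eventually (\<lambda>e. (cmod (g z - g p))\<^sup>2 * Im z * Im p
      \<le> (cmod (z - p))\<^sup>2 * (Im (g z) + e) * (Im (g p) + e)) (at_right 0)"
    by (auto simp: eventually_at_right_less intro: eventually_mono[OF eventually_at_right_less])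
  moreover have "((\<lambda>e. (cmod (z - p))\<^sup>2 * (Im (g z) + e) * (Im (g p) + e)) \<longlongrightarrow>
      (cmod (z - p))\<^sup>2 * (Im (g z) + 0) * (Im (g p) + 0)) (at_right 0)"
    by (intro tendsto_intros)
  ultimately show ?thesis
    using tendsto_lowerbound[of _ _ "at_right (0::real)"] by simp
qed

text \<open>Conjugating by a conformal map onto the disk that sends \<open>p\<close> to \<open>0\<close> gives the rigid case of
  the Schwarz lemma.\<close>

lemma halfplane_map_eq_identity:
  fixes g :: "complex \<Rightarrow> complex"
  assumes holg: "g holomorphic_on upper_halfplane"
    and pos: "\<And>z. Im z > 0 \<Longrightarrow> Im (g z) > 0"
    and p: "Im p > 0" and gp: "g p = p"
    and rigid: "deriv g p = 1 \<or> (\<exists>q. Im q > 0 \<and> q \<noteq> p \<and> g q = q)"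
    and z: "Im z > 0"
  shows "g z = z"
proof -
  define f where "f = (\<lambda>u. (g ((p - cnj p * u) / (1 - u)) - g p) / (g ((p - cnj p * u) / (1 - u)) - cnj (g p)))"
  have sc: "f holomorphic_on ball 0 1" "f 0 = 0" "\<And>u. norm u < 1 \<Longrightarrow> norm (f u) < 1"
    unfolding f_def by (rule schwarz_conjugate[OF holg _ p]; simp add: pos)+
  have pne: "p - cnj p \<noteq> 0"
    using p by (auto simp: complex_eq_iff)
  have fq: "f ((q - p) / (q - cnj p)) = (g q - p) / (g q - cnj p)" if "Im q > 0" for q
    using halfplane_quotient_inverse[OF that p] by (simp add: f_def gp)
  \<comment> \<open>Either alternative is an equality case of the Schwarz lemma, so \<open>f\<close>
    is a rotation; the derivative or the second fixed point then forces the factor to be 1.\<close>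
  have ex: "\<exists>c. (\<forall>u. norm u < 1 \<longrightarrow> f u = c * u) \<and> norm c = 1 \<and> c = 1"
    using rigid
  proof
    assume d: "deriv g p = 1"
    have "(g has_field_derivative 1) (at p)"
      using holomorphic_derivI[OF holg open_upper_halfplane, of p] p d by (simp add: upper_halfplane_def)
    then have gd: "(g has_field_derivative 1) (at ((p - cnj p * 0) / (1 - 0)))"
      by simp
    have "((\<lambda>u. (p - cnj p * u) / (1 - u)) has_field_derivative (p - cnj p)) (at 0)"
      by (auto intro!: derivative_eq_intros)
    from DERIV_chain2[OF gd this]
    have gd': "((\<lambda>u. g ((p - cnj p * u) / (1 - u))) has_field_derivative (p - cnj p)) (at 0)"
      by simp
    \<comment> \<open>At 0 the numerator of \<open>f\<close> vanishes and the denominator is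
      \<open>p - cnj p\<close>, which cancels the inner derivative.\<close>
    have "(f has_field_derivative 1) (at 0)"
      unfolding f_def
      by (rule derivative_eq_intros gd' refl | use pne in \<open>simp add: gp power2_eq_square\<close>)+
    then have df: "deriv f 0 = 1"
      by (rule DERIV_imp_deriv)
    then obtain c where c: "\<forall>u. norm u < 1 \<longrightarrow> f u = c * u" "norm c = 1"
      using Schwarz_Lemma(3)[OF sc, of 0] by auto
    have "(f has_field_derivative c) (at 0)"
    proof (rule has_field_derivative_transform_within_open[of "\<lambda>u. c * u" _ _ "ball 0 1"])
      show "((*) c has_field_derivative c) (at 0)"
        by (auto intro!: derivative_eq_intros)
    qed (use c in auto)
    then have "c = 1"
      using df DERIV_imp_deriv by fastforce
    then show ?thesis
      using c by blast
  next
    assume "\<exists>q. Im q > 0 \<and> q \<noteq> p \<and> g q = q"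
    then obtain q where q: "Im q > 0" "q \<noteq> p" "g q = q"
      by blast
    define u where "u = (q - p) / (q - cnj p)"
    have "q - cnj p \<noteq> 0"
      using q p by (auto simp: complex_eq_iff)
    then have u: "norm u < 1" "u \<noteq> 0" "f u = u"
      using norm_halfplane_quotient_less_one[OF q(1) p] fq[OF q(1)] q by (auto simp: u_def)
    then have "\<exists>z. norm z < 1 \<and> z \<noteq> 0 \<and> norm (f z) = norm z"
      by auto
    then obtain c where c: "\<forall>u. norm u < 1 \<longrightarrow> f u = c * u" "norm c = 1"
      using Schwarz_Lemma(3)[OF sc, of 0] by auto
    with u have "c = 1"
      by auto
    with c show ?thesis
      by blast
  qed
  then have "f ((z - p) / (z - cnj p)) = (z - p) / (z - cnj p)"
    using norm_halfplane_quotient_less_one[OF z p] by auto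
  then have "(g z - p) / (g z - cnj p) = (z - p) / (z - cnj p)"
    by (simp add: fq[OF z])
  moreover have "z - cnj p \<noteq> 0" "g z - cnj p \<noteq> 0"
    using z p pos[OF z] by (auto simp: complex_eq_iff)
  ultimately have "(g z - p) * (z - cnj p) = (z - p) * (g z - cnj p)"
    by (simp add: frac_eq_eq)
  then have "(g z - z) * (p - cnj p) = 0"
    by (simp add: algebra_simps)
  then show ?thesis
    using pne by simp
qed

subsection \<open>Julia points\<close>

text \<open>The inequality says that \<open>g\<close> maps every horodisk at \<open>w\<close> (every hyperbolic disk about \<open>w\<close>, if
  \<open>Im w > 0\<close>) into itself. It is closed under limits in \<open>g\<close> and \<open>w\<close>.\<close>

definition julia_point :: "(complex \<Rightarrow> complex) \<Rightarrow> complex \<Rightarrow> bool" where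
  "julia_point g w \<longleftrightarrow> Im w \<ge> 0 \<and>
     (\<forall>z. Im z > 0 \<longrightarrow> (cmod (g z - w))\<^sup>2 * Im z \<le> (cmod (z - w))\<^sup>2 * Im (g z))"

lemma julia_pointD:
  "julia_point g w \<Longrightarrow> Im z > 0 \<Longrightarrow> (cmod (g z - w))\<^sup>2 * Im z \<le> (cmod (z - w))\<^sup>2 * Im (g z)"
  by (simp add: julia_point_def)

lemma julia_point_interior_fixed:
  assumes "julia_point g w" "Im w > 0"
  shows "g w = w"
  using julia_pointD[OF assms] assms(2) by (simp add: mult_le_0_iff)

text \<open>A value off the open half-plane would make the right side of the Julia inequality
  nonpositive and so equal \<open>w\<close>. This supplies the strict positivity that the rigidity
  lemma asks for.\<close>

lemma julia_point_interior_Im_pos: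
  assumes J: "julia_point g w" and w: "Im w > 0" and z: "Im z > 0"
  shows "Im (g z) > 0"
proof (rule ccontr)
  assume "\<not> Im (g z) > 0"
  then have "(cmod (z - w))\<^sup>2 * Im (g z) \<le> 0"
    by (simp add: mult_nonneg_nonpos)
  then have "(cmod (g z - w))\<^sup>2 * Im z \<le> 0"
    using julia_pointD[OF J z] by linarith
  then have "g z = w"
    using z by (simp add: mult_le_0_iff)
  then show False
    using \<open>\<not> Im (g z) > 0\<close> w by simp
qed

lemma fixed_imp_julia_point:
  assumes "g holomorphic_on upper_halfplane" "\<And>z. Im z > 0 \<Longrightarrow> Im (g z) \<ge> 0"
    and "Im w > 0" "g w = w"
  shows "julia_point g w"
  unfolding julia_point_def using schwarz_pick[OF assms(1,2) _ assms(3)] assms(3,4) by auto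

text \<open>For each \<open>t\<close>, the disks about \<open>w0\<close> and \<open>w1\<close> through \<open>z\<close> are tangent at \<open>z\<close>: the weighted sum
  of the two inequalities at \<open>z\<close> has its unique minimum there. So \<open>g\<close> fixes \<open>z\<close>.\<close>

lemma julia_points_fixed_between:
  fixes t :: real
  assumes J0: "julia_point g w0" and J1: "julia_point g w1" and t: "0 < t" "t < 1"
    and ne: "w0 \<noteq> w1"
  defines "z \<equiv> Complex (t * Re w0 + (1 - t) * Re w1)
      (sqrt (t * (Im w0)\<^sup>2 + (1 - t) * (Im w1)\<^sup>2 + t * (1 - t) * (Re w0 - Re w1)\<^sup>2))"
  shows "Im z > 0 \<and> g z = z"
proof
  define r where "r = Im z"
  define K where "K = t * (Im w0)\<^sup>2 + (1 - t) * (Im w1)\<^sup>2 + t * (1 - t) * (Re w0 - Re w1)\<^sup>2"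
  have nonneg: "t * (Im w0)\<^sup>2 \<ge> 0" "(1 - t) * (Im w1)\<^sup>2 \<ge> 0" "t * (1 - t) * (Re w0 - Re w1)\<^sup>2 \<ge> 0"
    using t by auto
  have "K > 0"
  proof (rule ccontr)
    assume "\<not> K > 0"
    then have "t * (Im w0)\<^sup>2 = 0" "(1 - t) * (Im w1)\<^sup>2 = 0" "t * (1 - t) * (Re w0 - Re w1)\<^sup>2 = 0"
      using nonneg unfolding K_def by linarith+
    then show False
      using t ne by (simp add: complex_eq_iff)
  qed
  then show pos: "Im z > 0"
    by (simp add: z_def K_def)
  then have r: "r > 0"
    by (simp add: r_def)
  have rK: "r * r = K"
    using \<open>K > 0\<close> by (simp add: r_def z_def K_def)
  define X where "X = Re (g z)"
  define V where "V = Im (g z)"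
  define p where "p = Re z"
  have p: "p = t * Re w0 + (1 - t) * Re w1"
    by (simp add: p_def z_def)
  have "((X - Re w0)\<^sup>2 + (V - Im w0)\<^sup>2) * r \<le> ((p - Re w0)\<^sup>2 + (r - Im w0)\<^sup>2) * V"
    using julia_pointD[OF J0 pos] by (simp add: cmod_power2 X_def V_def p_def r_def)
  from mult_left_mono[OF this, of t]
  have 0: "t * (((X - Re w0)\<^sup>2 + (V - Im w0)\<^sup>2) * r) \<le> t * (((p - Re w0)\<^sup>2 + (r - Im w0)\<^sup>2) * V)"
    using t by simp
  have "((X - Re w1)\<^sup>2 + (V - Im w1)\<^sup>2) * r \<le> ((p - Re w1)\<^sup>2 + (r - Im w1)\<^sup>2) * V"
    using julia_pointD[OF J1 pos] by (simp add: cmod_power2 X_def V_def p_def r_def)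
  from mult_left_mono[OF this, of "1 - t"]
  have 1: "(1 - t) * (((X - Re w1)\<^sup>2 + (V - Im w1)\<^sup>2) * r)
      \<le> (1 - t) * (((p - Re w1)\<^sup>2 + (r - Im w1)\<^sup>2) * V)"
    using t by simp
  define q where "q = t * Im w0 + (1 - t) * Im w1"
  \<comment> \<open>In the weighted sum the terms in \<open>q\<close> agree on both sides, and
    \<open>r * r = K\<close> turns what remains into \<open>r\<close> times a sum of
    squares.\<close>
  have expand: "t * ((Y - Re w0)\<^sup>2 + (U - Im w0)\<^sup>2) + (1 - t) * ((Y - Re w1)\<^sup>2 + (U - Im w1)\<^sup>2)
      = (Y - p)\<^sup>2 + U\<^sup>2 - 2 * U * q + K" for Y U
    unfolding p q_def K_def by (simp add: power2_eq_square algebra_simps)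
  have "((X - p)\<^sup>2 + V\<^sup>2 - 2 * V * q + K) * r \<le> ((p - p)\<^sup>2 + r\<^sup>2 - 2 * r * q + K) * V"
    unfolding expand[symmetric] using add_mono[OF 0 1] by (simp add: algebra_simps)
  then have "r * ((X - p)\<^sup>2 + (V - r)\<^sup>2) \<le> 0"
    unfolding rK[symmetric] by (simp add: power2_eq_square algebra_simps)
  then have "(X - p)\<^sup>2 + (V - r)\<^sup>2 \<le> 0"
    using r by (simp add: mult_le_0_iff)
  then have "(X - p)\<^sup>2 + (V - r)\<^sup>2 = 0"
    by (intro antisym) auto
  then show "g z = z"
    by (simp add: sum_power2_eq_zero_iff complex_eq_iff X_def V_def p_def r_def)
qed

text \<open>Two values of \<open>t\<close> produce two distinct interior fixed points, and rigidity
  then makes \<open>g\<close> the identity. The values 1/3 and 2/3 are arbitrary.\<close>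

lemma julia_point_unique:
  assumes holg: "g holomorphic_on upper_halfplane"
    and nonneg: "\<And>z. Im z > 0 \<Longrightarrow> Im (g z) \<ge> 0"
    and not_id: "Im z0 > 0" "g z0 \<noteq> z0"
    and J: "julia_point g w0" "julia_point g w1"
  shows "w0 = w1"
proof (rule ccontr)
  assume ne: "w0 \<noteq> w1"
  define Z where "Z = (\<lambda>t. Complex (t * Re w0 + (1 - t) * Re w1)
      (sqrt (t * (Im w0)\<^sup>2 + (1 - t) * (Im w1)\<^sup>2 + t * (1 - t) * (Re w0 - Re w1)\<^sup>2)))"
  have Z: "Im (Z t) > 0" "g (Z t) = Z t" if "0 < t" "t < 1" for t
    using julia_points_fixed_between[OF J that ne] by (auto simp: Z_def)
  have dist: "Z (1/3) \<noteq> Z (2/3)"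
  proof
    assume eq: "Z (1/3) = Z (2/3)"
    then have "Re w0 = Re w1"
      by (simp add: Z_def)
    moreover from this eq have "(Im w0)\<^sup>2 = (Im w1)\<^sup>2"
      by (simp add: Z_def)
    then have "Im w0 = Im w1"
      using J by (simp add: julia_point_def)
    ultimately show False
      using ne by (simp add: complex_eq_iff)
  qed
  have J': "julia_point g (Z (1/3))"
    using fixed_imp_julia_point[OF holg nonneg] Z[of "1/3"] by simp
  have "g z0 = z0"
  proof (rule halfplane_map_eq_identity[OF holg _ _ _ _ not_id(1)])
    show "deriv g (Z (1/3)) = 1 \<or> (\<exists>q. Im q > 0 \<and> q \<noteq> Z (1/3) \<and> g q = q)"
      using Z[of "2/3"] dist by (auto intro!: exI[of _ "Z (2/3)"])
  qed (use Z[of "1/3"] julia_point_interior_Im_pos[OF J'] in auto)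
  then show False
    using not_id by simp
qed

text \<open>The Schwarz-Pick inequality makes the disk \<open>|z - p|^2 \<le> C Im z\<close> invariant for large \<open>C\<close>, and
  Brouwer's theorem applies to it.\<close>

lemma halfplane_fixed_point_exists:
  fixes g :: "complex \<Rightarrow> complex"
  assumes holg: "g holomorphic_on upper_halfplane"
    and \<eta>: "\<eta> > 0" "\<And>z. Im z > 0 \<Longrightarrow> Im (g z) \<ge> \<eta>"
    and p: "Im p > 0" "Im (g p) < Im p"
  shows "\<exists>z. Im z > 0 \<and> g z = z"
proof -
  define k where "k = cmod (g p - p)"
  \<comment> \<open>\<open>1 - e\<close> is the ratio by which \<open>g\<close> lowers the height of
    \<open>p\<close>. \<open>C\<close> is chosen to make \<open>Ce\<close> true; its summand 1 makes
    positivity immediate.\<close>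
  define e where "e = 1 - Im (g p) / Im p"
  define C where "C = (1 + 1 / e) * k\<^sup>2 / (e\<^sup>2 * \<eta>) + 1"
  have nonneg: "Im (g z) \<ge> 0" if "Im z > 0" for z
    using \<eta>(1) \<eta>(2)[OF that] by linarith
  have gp: "Im (g p) > 0"
    using \<eta> p(1) by (meson less_le_trans)
  have e: "0 < e" "e < 1"
    using p gp by (auto simp: e_def)
  have C: "C > 0"
    using e \<eta>(1) by (auto simp: C_def intro!: add_nonneg_pos divide_nonneg_nonneg mult_nonneg_nonneg)
  have Ce: "(1 + 1 / e) * k\<^sup>2 \<le> e\<^sup>2 * C * \<eta>"
  proof -
    have "e\<^sup>2 * C * \<eta> = (1 + 1 / e) * k\<^sup>2 + e\<^sup>2 * \<eta>"
      using e \<eta>(1) by (simp add: C_def field_simps)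
    then show ?thesis
      using e \<eta>(1) by simp
  qed
  \<comment> \<open>Completing the square shows that \<open>|z - p|^2 \<le> C Im z\<close> is a
    Euclidean disk with this centre and radius \<open>\<rho>\<close>.\<close>
  define c where "c = p + \<i> * of_real (C / 2)"
  define \<rho> where "\<rho> = sqrt (C\<^sup>2 / 4 + C * Im p)"
  have \<rho>: "\<rho> > 0" "\<rho>\<^sup>2 = C\<^sup>2 / 4 + C * Im p"
    using C p(1) by (auto simp: \<rho>_def intro!: add_pos_pos)
  have disk: "z \<in> cball c \<rho> \<longleftrightarrow> (cmod (z - p))\<^sup>2 \<le> C * Im z" for z
  proof -
    have "z \<in> cball c \<rho> \<longleftrightarrow> (cmod (z - c))\<^sup>2 \<le> \<rho>\<^sup>2"
      using \<rho>(1) by (simp add: dist_norm norm_minus_commute)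
    also have "(cmod (z - c))\<^sup>2 = (cmod (z - p))\<^sup>2 - C * (Im z - Im p) + C\<^sup>2 / 4"
      unfolding cmod_power2 by (simp add: c_def power2_eq_square field_simps)
    finally show ?thesis
      unfolding \<rho>(2) by (simp add: algebra_simps)
  qed
  have pos: "Im z > 0" if "z \<in> cball c \<rho>" for z
  proof -
    have le: "(cmod (z - p))\<^sup>2 \<le> C * Im z"
      using that disk by blast
    then have "0 \<le> C * Im z"
      using zero_le_power2 order_trans by blast
    then have "Im z \<ge> 0"
      using C by (simp add: zero_le_mult_iff)
    moreover have "Im z \<noteq> 0"
    proof
      assume "Im z = 0"
      with le have "z = p"
        by simp
      with \<open>Im z = 0\<close> p show False
        by simp
    qed
    ultimately show ?thesis
      by simp
  qed
  have "g z \<in> cball c \<rho>" if z: "z \<in> cball c \<rho>" for z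
  proof -
    define A where "A = cmod (g z - g p)"
    have zp: "Im z > 0"
      using pos z .
    have gz: "Im (g z) \<ge> \<eta>"
      using \<eta>(2) zp .
    have "A\<^sup>2 * (Im z * Im p) \<le> (cmod (z - p))\<^sup>2 * (Im (g z) * Im (g p))"
      unfolding A_def using schwarz_pick[OF holg nonneg zp p(1)] by (simp add: mult.assoc)
    also have "\<dots> \<le> (C * Im z) * (Im (g z) * Im (g p))"
      using z disk gz \<eta>(1) gp by (intro mult_right_mono) auto
    also have "\<dots> = (C * (1 - e) * Im (g z)) * (Im z * Im p)"
      using p(1) by (simp add: e_def)
    finally have A: "A\<^sup>2 \<le> C * (1 - e) * Im (g z)"
      using zp p(1) by simp
    have "cmod (g z - p) \<le> A + k"
      unfolding A_def k_def using norm_triangle_ineq[of "g z - g p" "g p - p"] by simp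
    then have "(cmod (g z - p))\<^sup>2 \<le> (A + k)\<^sup>2"
      by (rule power_mono) simp
    \<comment> \<open>Young's inequality with weight \<open>e\<close>, written as an identity. The
      point is that \<open>(1 + e) (1 - e) + e^2 = 1\<close>: the contraction at \<open>p\<close>
      leaves exactly \<open>e^2\<close> to absorb the \<open>k^2\<close> term.\<close>
    also have "\<dots> = (1 + e) * A\<^sup>2 + (1 + 1 / e) * k\<^sup>2 - (e * A - k)\<^sup>2 / e"
      using e by (simp add: power2_eq_square field_simps)
    also have "\<dots> \<le> (1 + e) * A\<^sup>2 + (1 + 1 / e) * k\<^sup>2"
      using e by simp
    also have "\<dots> \<le> (1 + e) * (C * (1 - e) * Im (g z)) + e\<^sup>2 * C * Im (g z)"
    proof (rule add_mono)
      have "e\<^sup>2 * C * \<eta> \<le> e\<^sup>2 * C * Im (g z)"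
        using e C gz by (intro mult_left_mono) auto
      then show "(1 + 1 / e) * k\<^sup>2 \<le> e\<^sup>2 * C * Im (g z)"
        using Ce by linarith
    qed (use A e in \<open>auto intro!: mult_left_mono\<close>)
    also have "\<dots> = C * Im (g z)"
      by (simp add: power2_eq_square algebra_simps)
    finally show ?thesis
      using disk by blast
  qed
  moreover have "continuous_on (cball c \<rho>) g"
    using holomorphic_on_imp_continuous_on[OF holg] by (rule continuous_on_subset)
      (auto simp: upper_halfplane_def pos)
  ultimately obtain z where "z \<in> cball c \<rho>" "g z = z"
    using brouwer_ball[OF \<rho>(1)] by blast
  then show ?thesis
    using pos by blast
qed

text \<open>The Julia-Caratheodory theorem. The reciprocals \<open>-1 / (z - w)\<close> and \<open>-1 / (g z - w)\<close> move \<open>w\<close>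
  to \<open>\<infinity>\<close>, where \<open>g\<close> becomes \<open>b \<zeta> + n\<close> with \<open>b \<ge> 1\<close> the largest constant such that \<open>Im n \<ge> 0\<close>;
  Schwarz-Pick for \<open>n\<close> shows that \<open>n\<close> is negligible in cones.\<close>

lemma julia_point_angular_derivative:
  fixes g :: "complex \<Rightarrow> complex"
  assumes holg: "g holomorphic_on upper_halfplane"
    and nonneg: "\<And>z. Im z > 0 \<Longrightarrow> Im (g z) \<ge> 0"
    and J: "julia_point g w" and w: "Im w = 0"
  shows "\<exists>c\<le>1. \<forall>M>0. ((\<lambda>z. (g z - w) / (z - w)) \<longlongrightarrow> of_real c)
           (at w within {z. Im z > 0 \<and> cmod (z - w) \<le> M * Im z})"
proof (cases "\<exists>z1. Im z1 > 0 \<and> g z1 = w")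
  case True
  then obtain z1 where z1: "Im z1 > 0" "g z1 = w"
    by blast
  \<comment> \<open>An interior value on the real line makes the right side of Schwarz-Pick vanish,
    so \<open>g\<close> is constant and the angular derivative is 0.\<close>
  have const: "g z = w" if "Im z > 0" for z
  proof -
    have "(cmod (g z - w))\<^sup>2 * Im z * Im z1 \<le> 0"
      using schwarz_pick[OF holg nonneg that z1(1)] z1 w by simp
    then show ?thesis
      using that z1(1) by (simp add: mult_le_0_iff)
  qed
  have "((\<lambda>z. (g z - w) / (z - w)) \<longlongrightarrow> of_real 0)
           (at w within {z. Im z > 0 \<and> cmod (z - w) \<le> M * Im z})" for M
    by (rule tendsto_eventually) (auto simp: eventually_at_filter const)
  then show ?thesis
    by (intro exI[of _ 0]) auto
next
  case False
  then have gne: "g z - w \<noteq> 0" if "Im z > 0" for z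
    using that by auto
  have zne: "z - w \<noteq> 0" if "Im z > 0" for z
    using that w by auto
  have Im_recip: "Im (- 1 / (z - w)) = Im z / (cmod (z - w))\<^sup>2" for z
    by (simp add: Im_divide cmod_power2 w)
  \<comment> \<open>The ratio of heights once \<open>w\<close> has been moved to infinity. The Julia
    inequality says that it is at least 1, and its infimum \<open>b\<close> is the reciprocal of the
    angular derivative.\<close>
  define ratio where "ratio = (\<lambda>z. Im (- 1 / (g z - w)) / Im (- 1 / (z - w)))"
  have e0: "Im (- 1 / (z - w)) > 0" if "Im z > 0" for z
    unfolding Im_recip using that zne[OF that] by simp
  have ratio1: "ratio z \<ge> 1" if "Im z > 0" for z
  proof -
    have "Im z / (cmod (z - w))\<^sup>2 \<le> Im (g z) / (cmod (g z - w))\<^sup>2"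
      using julia_pointD[OF J that] gne[OF that] zne[OF that] by (simp add: field_simps)
    then have "Im (- 1 / (z - w)) \<le> Im (- 1 / (g z - w))"
      by (simp only: Im_recip)
    then show ?thesis
      using e0[OF that] by (simp add: ratio_def)
  qed
  define S where "S = ratio ` {z. Im z > 0}"
  define b where "b = Inf S"
  have S: "S \<noteq> {}" "bdd_below S"
    using ratio1 by (auto simp: S_def intro!: exI[of _ \<i>] bdd_belowI2[of _ 1])
  have b1: "b \<ge> 1"
    unfolding b_def using S ratio1 by (intro cInf_greatest) (auto simp: S_def)
  define n where "n = (\<lambda>z. - 1 / (g z - w) - of_real b * (- 1 / (z - w)))"
  have Imn: "Im (n z) = (ratio z - b) * Im (- 1 / (z - w))" if "Im z > 0" for z
  proof -
    have Im_b: "Im (of_real b * x) = b * Im x" for x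
      by simp
    have "Im (n z) = Im (- 1 / (g z - w)) - b * Im (- 1 / (z - w))"
      by (simp only: n_def minus_complex.sel Im_b)
    also have "Im (- 1 / (g z - w)) = ratio z * Im (- 1 / (z - w))"
      using e0[OF that] by (simp add: ratio_def)
    finally show ?thesis
      by (simp add: left_diff_distrib)
  qed
  have Imn0: "Im (n z) \<ge> 0" if "Im z > 0" for z
  proof -
    have "b \<le> ratio z"
      unfolding b_def using S(2) that by (intro cInf_lower) (auto simp: S_def)
    then show ?thesis
      unfolding Imn[OF that] using e0[OF that] by (intro mult_nonneg_nonneg) linarith+
  qed
  have holn: "n holomorphic_on upper_halfplane"
    unfolding n_def using gne zne
    by (intro holomorphic_intros holg) (auto simp: upper_halfplane_def)
  have lim: "((\<lambda>z. (g z - w) / (z - w)) \<longlongrightarrow> of_real (1 / b))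
           (at w within {z. Im z > 0 \<and> cmod (z - w) \<le> M * Im z})" if M: "M > 0" for M
  proof -
    let ?F = "at w within {z. Im z > 0 \<and> cmod (z - w) \<le> M * Im z}"
    have "((\<lambda>z. (z - w) * n z) \<longlongrightarrow> 0) ?F"
    proof (rule tendstoI)
      fix e :: real assume e: "e > 0"
      \<comment> \<open>A nearly minimizing \<open>z0\<close> makes \<open>Im (n z0)\<close> small
        relative to the height of \<open>-1 / (z0 - w)\<close>. The constant 16 makes the main error
        \<open>8 * d * M\<close> equal to \<open>e / 2\<close>.\<close>
      define d where "d = e / (16 * M)"
      have d: "d > 0"
        using e M by (simp add: d_def)
      obtain z0 where z0: "Im z0 > 0" "ratio z0 < b + d"
        using cInf_lessD[OF S(1), of "b + d"] d by (auto simp: b_def S_def)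
      define D where "D = cmod (z0 - w)"
      have D: "D > 0"
        using zne[OF z0(1)] by (simp add: D_def)
      have n0: "Im (n z0) \<le> d * (Im z0 / D\<^sup>2)"
      proof -
        have "Im (n z0) \<le> d * Im (- 1 / (z0 - w))"
          unfolding Imn[OF z0(1)] using z0(2) e0[OF z0(1)] by (intro mult_right_mono) auto
        then show ?thesis
          by (simp only: Im_recip D_def)
      qed
      define N where "N = cmod (n z0)"
      \<comment> \<open>The first bound gives \<open>|z - z0| \<le> 2 D\<close>; the second brings
        the contribution of \<open>N\<close> below \<open>e / 2\<close>.\<close>
      define \<delta> where "\<delta> = min D (e / (4 * (N + 1)))"
      have N: "N \<ge> 0"
        by (simp add: N_def)
      have \<delta>: "\<delta> > 0"
        using D e N by (auto simp: \<delta>_def)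
      have "norm ((z - w) * n z) < e"
        if z: "Im z > 0" "cmod (z - w) \<le> M * Im z" "cmod (z - w) < \<delta>" for z
      proof -
        define s where "s = cmod (z - w)"
        define X where "X = cmod (n z - n z0)"
        have s: "s > 0" "s \<le> M * Im z" "s < D" "s < e / (4 * (N + 1))"
          using z zne[OF z(1)] by (auto simp: s_def \<delta>_def)
        have nz: "cmod (n z) \<le> X + N"
          using norm_triangle_ineq[of "n z - n z0" "n z0"] by (simp add: X_def N_def)
        have "cmod (z - z0) \<le> 2 * D"
          using norm_triangle_ineq4[of "z - w" "z0 - w"] s(3) by (simp add: D_def s_def)
        then have zz0: "(cmod (z - z0))\<^sup>2 \<le> (2 * D)\<^sup>2"
          by (rule power_mono) simp
        have "X\<^sup>2 * Im z * Im z0 \<le> (cmod (z - z0))\<^sup>2 * Im (n z) * Im (n z0)"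
          unfolding X_def by (rule schwarz_pick[OF holn Imn0 z(1) z0(1)])
        also have "\<dots> \<le> (2 * D)\<^sup>2 * Im (n z) * (d * (Im z0 / D\<^sup>2))"
          using zz0 n0 Imn0[OF z(1)] Imn0[OF z0(1)] by (intro mult_mono) auto
        also have "\<dots> = (4 * d * Im (n z)) * Im z0"
          using D by (simp add: field_simps)
        finally have "X\<^sup>2 * Im z \<le> 4 * d * Im (n z)"
          using z0(1) by simp
        also have "\<dots> \<le> 4 * d * (X + N)"
          using d nz abs_Im_le_cmod[of "n z"] by (intro mult_left_mono) auto
        finally have "M * (X\<^sup>2 * Im z) \<le> M * (4 * d * (X + N))"
          using M by (intro mult_left_mono) auto
        moreover have "X\<^sup>2 * s \<le> X\<^sup>2 * (M * Im z)"
          using s(2) by (intro mult_left_mono) auto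
        ultimately have Xs: "X\<^sup>2 * s \<le> 4 * d * M * (X + N)"
          by (simp add: algebra_simps)
        \<comment> \<open>\<open>Xs\<close> is quadratic in \<open>X\<close>: when
          \<open>X > N\<close>, the sum \<open>X + N\<close> is at most \<open>2 X\<close> and one
          factor \<open>X\<close> cancels.\<close>
        have "s * (X + N) \<le> 8 * d * M + 2 * (s * N)"
        proof (cases "X \<le> N")
          case True
          then have "s * (X + N) \<le> s * (2 * N)"
            using s(1) by (intro mult_left_mono) auto
          moreover have "8 * d * M > 0"
            using d M by simp
          ultimately show ?thesis
            by linarith
        next
          case False
          then have X: "X > 0"
            using N by linarith
          have "4 * d * M * (X + N) \<le> 4 * d * M * (2 * X)"
            using False d M by (intro mult_left_mono) auto
          with Xs have "X * (s * X) \<le> X * (8 * d * M)"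
            by (simp add: power2_eq_square algebra_simps)
          then have "s * X \<le> 8 * d * M"
            using X by simp
          moreover have "s * N \<ge> 0"
            using s N by simp
          ultimately show ?thesis
            by (simp add: algebra_simps)
        qed
        moreover have "8 * d * M = e / 2"
          using M by (simp add: d_def)
        moreover have "2 * (s * N) < e / 2"
        proof -
          have "s * (4 * (N + 1)) < e"
            using s(4) N by (simp add: field_simps)
          then show ?thesis
            using s(1) by (simp add: algebra_simps)
        qed
        moreover have "norm ((z - w) * n z) \<le> s * (X + N)"
          unfolding norm_mult s_def[symmetric] using nz s(1) by (intro mult_left_mono) auto
        ultimately show ?thesis
          by linarith
      qed
      then show "eventually (\<lambda>z. dist ((z - w) * n z) 0 < e) ?F"
        unfolding eventually_at using \<delta> by (auto simp: dist_norm intro!: exI[of _ \<delta>])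
    qed
    then have "((\<lambda>z. of_real b - (z - w) * n z) \<longlongrightarrow> of_real b - 0) ?F"
      by (intro tendsto_intros)
    moreover have "eventually (\<lambda>z. of_real b - (z - w) * n z = (z - w) / (g z - w)) ?F"
    proof -
      have "of_real b - (z - w) * n z = (z - w) / (g z - w)" if "Im z > 0" for z
        using zne[OF that] gne[OF that] by (simp add: n_def divide_simps)
      then show ?thesis
        by (auto simp: eventually_at_filter)
    qed
    ultimately have "((\<lambda>z. (z - w) / (g z - w)) \<longlongrightarrow> of_real b) ?F"
      using tendsto_cong by fastforce
    then have "((\<lambda>z. inverse ((z - w) / (g z - w))) \<longlongrightarrow> inverse (of_real b)) ?F"
      by (rule tendsto_inverse) (use b1 in auto)
    then show ?thesis
      by (simp add: inverse_eq_divide)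
  qed
  moreover have "1 / b \<le> 1"
    using b1 by simp
  ultimately show ?thesis
    by blast
qed

subsection \<open>Denjoy-Wolff points in the disk\<close>

lemma plus_i_nonzero: "Im z \<ge> 0 \<Longrightarrow> z + \<i> \<noteq> 0"
  by (auto simp: complex_eq_iff)

lemma cayley_diff:
  assumes "Im z \<ge> 0" "Im w \<ge> 0"
  shows "cayley z - cayley w = 2 * \<i> * (z - w) / ((z + \<i>) * (w + \<i>))"
  using plus_i_nonzero[OF assms(1)] plus_i_nonzero[OF assms(2)]
  by (simp add: cayley_def field_simps)

text \<open>Together with \<open>one_minus_norm_cayley_power2\<close> this carries Schwarz-Pick and
  Julia inequalities between disk and half-plane: the factors \<open>|z + \<i>|^2\<close> are the
  same on both sides.\<close>

lemma norm_cayley_diff_power2: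
  assumes "Im z \<ge> 0" "Im w \<ge> 0"
  shows "(cmod (cayley z - cayley w))\<^sup>2
    = 4 * (cmod (z - w))\<^sup>2 / ((cmod (z + \<i>))\<^sup>2 * (cmod (w + \<i>))\<^sup>2)"
  by (simp add: cayley_diff[OF assms] norm_divide norm_mult power_divide power_mult_distrib)

lemma one_minus_norm_cayley_power2:
  assumes "Im z \<ge> 0"
  shows "1 - (cmod (cayley z))\<^sup>2 = 4 * Im z / (cmod (z + \<i>))\<^sup>2"
proof -
  have "(cmod (z + \<i>))\<^sup>2 > 0"
    using plus_i_nonzero[OF assms] by simp
  moreover have "(cmod (z + \<i>))\<^sup>2 - (cmod (z - \<i>))\<^sup>2 = 4 * Im z"
    unfolding cmod_power2 by (simp add: power2_eq_square algebra_simps)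
  ultimately have "1 - (cmod (z - \<i>))\<^sup>2 / (cmod (z + \<i>))\<^sup>2 = 4 * Im z / (cmod (z + \<i>))\<^sup>2"
    by (metis diff_divide_distrib divide_self less_irrefl)
  then show ?thesis
    by (simp add: cayley_def norm_divide power_divide)
qed

lemma cayley_neq_1: "Im z \<ge> 0 \<Longrightarrow> cayley z \<noteq> 1"
  using plus_i_nonzero[of z] by (simp add: cayley_def divide_eq_1_iff)

lemma norm_one_minus_cayley_power2:
  assumes "Im z \<ge> 0"
  shows "(cmod (cayley z - 1))\<^sup>2 = 4 / (cmod (z + \<i>))\<^sup>2"
proof -
  have "cayley z - 1 = - 2 * \<i> / (z + \<i>)"
    using plus_i_nonzero[OF assms] by (simp add: cayley_def field_simps)
  then show ?thesis
    by (simp add: norm_divide norm_mult power_divide)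
qed

lemma norm_cayley_le_1: "Im z \<ge> 0 \<Longrightarrow> cmod (cayley z) \<le> 1"
  using one_minus_norm_cayley_power2[of z] plus_i_nonzero[of z]
  by (metis abs_norm_cancel abs_square_le_1 diff_ge_0_iff_ge divide_nonneg_nonneg
      mult_nonneg_nonneg zero_le_numeral zero_le_power2)

lemma norm_cayley_less_1: "Im z > 0 \<Longrightarrow> cmod (cayley z) < 1"
  using bij_betw_apply[OF bij_betw_cayley, of z] by (simp add: upper_halfplane_def)

lemma norm_cayley_real:
  assumes "Im z = 0"
  shows "cmod (cayley z) = 1"
proof -
  have "(cmod (cayley z))\<^sup>2 = 1\<^sup>2"
    using one_minus_norm_cayley_power2[of z] assms by simp
  then show ?thesis
    by (rule power2_eq_imp_eq) auto
qed

lemma cayley_inv_cayley_disk: "cmod u < 1 \<Longrightarrow> cayley (inv_cayley u) = u"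
  by (rule cayley_inv_cayley) auto

lemma inv_cayley_in_halfplane: "cmod u < 1 \<Longrightarrow> Im (inv_cayley u) > 0"
  using Im_halfplane_quotient_inverse[of u \<i>] by (simp add: inv_cayley_def algebra_simps)

lemma Im_inv_cayley_unit_circle:
  assumes "cmod u = 1"
  shows "Im (inv_cayley u) = 0"
proof -
  have "(cmod u)\<^sup>2 = 1"
    using assms by simp
  then have "1 - (Re u)\<^sup>2 - (Im u)\<^sup>2 = 0"
    unfolding cmod_power2 by simp
  moreover have "Im (inv_cayley u) = (1 - (Re u)\<^sup>2 - (Im u)\<^sup>2) / ((Re (1 - u))\<^sup>2 + (Im (1 - u))\<^sup>2)"
    unfolding inv_cayley_def Im_divide by (simp add: power2_eq_square algebra_simps)
  ultimately show ?thesis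
    by simp
qed

section \<open>Schwarz-Pick and Julia inequalities in the disk\<close>

text \<open>Both sides are \<open>64 / K\<close> times those of \<open>schwarz_pick\<close>, so
  values of \<open>f\<close> on the unit circle are covered too.\<close>

lemma schwarz_pick_disk:
  fixes g :: "complex \<Rightarrow> complex"
  assumes holg: "g holomorphic_on upper_halfplane"
    and nonneg: "\<And>z. Im z > 0 \<Longrightarrow> Im (g z) \<ge> 0"
    and u: "cmod u < 1" and u': "cmod u' < 1"
  defines "f \<equiv> cayley \<circ> g \<circ> inv_cayley"
  shows "(cmod (f u - f u'))\<^sup>2 * (1 - (cmod u)\<^sup>2) * (1 - (cmod u')\<^sup>2)
    \<le> (cmod (u - u'))\<^sup>2 * (1 - (cmod (f u))\<^sup>2) * (1 - (cmod (f u'))\<^sup>2)"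
proof -
  define z where "z = inv_cayley u"
  define p where "p = inv_cayley u'"
  have z: "Im z > 0" and p: "Im p > 0"
    using u u' inv_cayley_in_halfplane by (auto simp: z_def p_def)
  have eq: "u = cayley z" "u' = cayley p" "f u = cayley (g z)" "f u' = cayley (g p)"
    using u u' by (auto simp: z_def p_def f_def cayley_inv_cayley_disk)
  define K where "K = (cmod (g z + \<i>))\<^sup>2 * (cmod (g p + \<i>))\<^sup>2 * ((cmod (z + \<i>))\<^sup>2 * (cmod (p + \<i>))\<^sup>2)"
  have K: "K > 0"
    using plus_i_nonzero[OF nonneg[OF z]] plus_i_nonzero[OF nonneg[OF p]]
      plus_i_nonzero[of z] plus_i_nonzero[of p] z p by (simp add: K_def)
  have "(cmod (f u - f u'))\<^sup>2 * (1 - (cmod u)\<^sup>2) * (1 - (cmod u')\<^sup>2)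
      = 64 * ((cmod (g z - g p))\<^sup>2 * Im z * Im p) / K"
    unfolding eq(3,4) unfolding eq(1,2) using z p nonneg
    by (simp add: norm_cayley_diff_power2 one_minus_norm_cayley_power2 K_def mult_ac)
  also have "\<dots> \<le> 64 * ((cmod (z - p))\<^sup>2 * Im (g z) * Im (g p)) / K"
    using schwarz_pick[OF holg nonneg z p] K by (intro divide_right_mono mult_left_mono) auto
  also have "\<dots> = (cmod (u - u'))\<^sup>2 * (1 - (cmod (f u))\<^sup>2) * (1 - (cmod (f u'))\<^sup>2)"
    unfolding eq(3,4) unfolding eq(1,2) using z p nonneg
    by (simp add: norm_cayley_diff_power2 one_minus_norm_cayley_power2 K_def mult_ac)
  finally show ?thesis .
qed

text \<open>Julia's lemma: put \<open>u' = r v\<close> in the Schwarz-Pick inequality, divide by \<open>1 - r\<close> and let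
  \<open>r\<close> tend to \<open>1\<close>; the factor \<open>1 - |f (r v)|^2\<close> is at most \<open>2 Re (1 - cnj v * f (r v))\<close>.\<close>

lemma boundary_denjoy_wolff_imp_julia:
  fixes g :: "complex \<Rightarrow> complex"
  assumes holg: "g holomorphic_on upper_halfplane"
    and nonneg: "\<And>z. Im z > 0 \<Longrightarrow> Im (g z) \<ge> 0"
  defines "f \<equiv> cayley \<circ> g \<circ> inv_cayley"
  assumes DW: "denjoy_wolff_point f v" and v: "cmod v = 1" and u: "cmod u < 1"
  shows "(cmod (f u - v))\<^sup>2 * (1 - (cmod u)\<^sup>2) \<le> (cmod (u - v))\<^sup>2 * (1 - (cmod (f u))\<^sup>2)"
proof -
  have img: "f ` ball 0 1 \<subseteq> cball 0 1"
    using DW by (simp add: denjoy_wolff_point_def)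
  obtain c :: real where c: "c \<le> 1"
    and lim1: "has_nontangential_limit f v v"
    and lim2: "has_nontangential_limit (\<lambda>z. (f z - v) / (z - v)) v (of_real c)"
    using DW v by (auto simp: denjoy_wolff_point_def)
  \<comment> \<open>On the radius \<open>|R r - v| = 1 - r\<close>, so the path lies in the Stolz
    region with constant 2.\<close>
  define R where "R = (\<lambda>r::real. of_real r * v)"
  have R: "filterlim R (at v within stolz_region v 2) (at_left 1)"
    unfolding filterlim_at
  proof
    have "(R \<longlongrightarrow> of_real 1 * v) (at_left 1)"
      unfolding R_def by (intro tendsto_intros)
    then show "(R \<longlongrightarrow> v) (at_left 1)"
      by simp
    have "R r \<in> stolz_region v 2 \<and> R r \<noteq> v" if r: "0 < r" "r < 1" for r
    proof -
      have "R r - v = of_real (r - 1) * v"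
        by (simp add: R_def algebra_simps)
      then have "cmod (R r - v) = 1 - r" "cmod (R r) = r"
        using r v by (simp_all add: norm_mult R_def del: of_real_diff)
      then show ?thesis
        using r by (auto simp: stolz_region_def)
    qed
    then show "eventually (\<lambda>r. R r \<in> stolz_region v 2 \<and> R r \<noteq> v) (at_left 1)"
      unfolding eventually_at_left_field by (intro exI[of _ 0]) auto
  qed
  have fR: "((\<lambda>r. f (R r)) \<longlongrightarrow> v) (at_left 1)"
    by (rule filterlim_compose[OF _ R]) (use lim1 in \<open>auto simp: has_nontangential_limit_def\<close>)
  have qR: "((\<lambda>r. (f (R r) - v) / (R r - v)) \<longlongrightarrow> of_real c) (at_left 1)"
    by (rule filterlim_compose[OF _ R]) (use lim2 in \<open>auto simp: has_nontangential_limit_def\<close>)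
  have Rlim: "(R \<longlongrightarrow> v) (at_left 1)"
    using R by (simp add: filterlim_at)
  have ineq: "(cmod (f u - f (R r)))\<^sup>2 * (1 - (cmod u)\<^sup>2) * (1 + r)
      \<le> (cmod (u - R r))\<^sup>2 * (1 - (cmod (f u))\<^sup>2) * (2 * Re ((f (R r) - v) / (R r - v)))"
    if r: "0 < r" "r < 1" for r
  proof -
    have nR: "cmod (R r) = r"
      using r v by (simp add: R_def norm_mult)
    have fu: "cmod (f u) \<le> 1" "cmod (f (R r)) \<le> 1"
      using img u r nR by (auto simp: image_subset_iff)
    define q where "q = (f (R r) - v) / (R r - v)"
    have vv: "cnj v * v = 1"
      using v by (simp add: mult.commute complex_norm_square[symmetric])
    have vne: "v \<noteq> 0"
      using v by auto
    have Rv: "R r - v = - (of_real (1 - r) * v)"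
      by (simp add: R_def algebra_simps)
    then have "f (R r) - v = - (q * of_real (1 - r) * v)"
      using r vne by (simp add: q_def)
    then have fRr: "f (R r) = v - q * of_real (1 - r) * v"
      by (metis add.commute diff_conv_add_uminus diff_eq_eq)
    have "cnj v * f (R r) = cnj v * v - q * of_real (1 - r) * (cnj v * v)"
      unfolding fRr by (simp only: right_diff_distrib mult_ac)
    then have "1 - cnj v * f (R r) = q * of_real (1 - r)"
      unfolding vv by simp
    moreover have "cmod (cnj v * f (R r)) = cmod (f (R r))"
      using v by (simp add: norm_mult)
    \<comment> \<open>The modulus of \<open>cnj v * f (R r)\<close> dominates its real part, which
      is \<open>1 - (1 - r) Re q\<close>.\<close>
    ultimately have A: "1 - cmod (f (R r)) \<le> (1 - r) * Re q"
      using complex_Re_le_cmod[of "cnj v * f (R r)"]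
      by (metis (no_types, opaque_lifting) Re_complex_of_real Im_complex_of_real diff_left_mono
          minus_complex.sel(1) mult.commute mult_zero_left one_complex.sel(1) times_complex.sel(1)
          diff_zero)
    have "1 - (cmod (f (R r)))\<^sup>2 \<le> 2 * (1 - cmod (f (R r)))"
    proof -
      have "0 \<le> (1 - cmod (f (R r)))\<^sup>2"
        by simp
      then show ?thesis
        by (simp add: power2_eq_square algebra_simps)
    qed
    also have "\<dots> \<le> 2 * ((1 - r) * Re q)"
      using A by (rule mult_left_mono) simp
    also have "\<dots> = (1 - r) * (2 * Re q)"
      by (simp only: mult_ac)
    finally have B: "1 - (cmod (f (R r)))\<^sup>2 \<le> (1 - r) * (2 * Re q)" .
    have "(cmod (f u - f (R r)))\<^sup>2 * (1 - (cmod u)\<^sup>2) * (1 - r\<^sup>2)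
        \<le> (cmod (u - R r))\<^sup>2 * (1 - (cmod (f u))\<^sup>2) * (1 - (cmod (f (R r)))\<^sup>2)"
      using schwarz_pick_disk[OF holg nonneg u, of "R r"] r nR by (simp add: f_def)
    also have "\<dots> \<le> (cmod (u - R r))\<^sup>2 * (1 - (cmod (f u))\<^sup>2) * ((1 - r) * (2 * Re q))"
      using B fu(1) by (intro mult_left_mono mult_nonneg_nonneg) (auto simp: abs_square_le_1)
    finally have "(1 - r) * ((cmod (f u - f (R r)))\<^sup>2 * (1 - (cmod u)\<^sup>2) * (1 + r))
        \<le> (1 - r) * ((cmod (u - R r))\<^sup>2 * (1 - (cmod (f u))\<^sup>2) * (2 * Re q))"
      by (simp add: power2_eq_square algebra_simps)
    then show ?thesis
      unfolding q_def using r by simp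
  qed
  \<comment> \<open>In the limit \<open>1 + r\<close> becomes 2 and the quotient becomes
    \<open>c\<close>, which is at most 1, so the factors 2 cancel.\<close>
  have "(cmod (f u - v))\<^sup>2 * (1 - (cmod u)\<^sup>2) * (1 + 1)
      \<le> (cmod (u - v))\<^sup>2 * (1 - (cmod (f u))\<^sup>2) * (2 * Re (of_real c))"
  proof (rule tendsto_le[of "at_left (1::real)"])
    show "eventually (\<lambda>r. (cmod (f u - f (R r)))\<^sup>2 * (1 - (cmod u)\<^sup>2) * (1 + r)
      \<le> (cmod (u - R r))\<^sup>2 * (1 - (cmod (f u))\<^sup>2) * (2 * Re ((f (R r) - v) / (R r - v)))) (at_left 1)"
      unfolding eventually_at_left_field using ineq by (intro exI[of _ 0]) auto
  qed (intro tendsto_intros fR qR Rlim | simp)+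
  also have "\<dots> \<le> (cmod (u - v))\<^sup>2 * (1 - (cmod (f u))\<^sup>2) * 2"
    using c img u by (intro mult_left_mono mult_nonneg_nonneg) (auto simp: abs_square_le_1 image_subset_iff)
  finally show ?thesis
    by simp
qed

lemma disk_julia_imp_julia_point:
  assumes nonneg: "\<And>z. Im z > 0 \<Longrightarrow> Im (g z) \<ge> 0" and w: "Im w \<ge> 0"
    and J: "\<And>u. cmod u < 1 \<Longrightarrow> (cmod ((cayley \<circ> g \<circ> inv_cayley) u - cayley w))\<^sup>2 * (1 - (cmod u)\<^sup>2)
      \<le> (cmod (u - cayley w))\<^sup>2 * (1 - (cmod ((cayley \<circ> g \<circ> inv_cayley) u))\<^sup>2)"
  shows "julia_point g w"
  unfolding julia_point_def
proof (intro conjI allI impI)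
  fix z :: complex assume z: "Im z > 0"
  define K where "K = (cmod (g z + \<i>))\<^sup>2 * (cmod (w + \<i>))\<^sup>2 * (cmod (z + \<i>))\<^sup>2"
  have K: "K > 0"
    using plus_i_nonzero[OF nonneg[OF z]] plus_i_nonzero[of z] plus_i_nonzero[OF w] z
    by (simp add: K_def)
  have "inv_cayley (cayley z) = z"
    using z by (simp add: inv_cayley_cayley closed_upper_halfplane_def)
  then have "(cmod (cayley (g z) - cayley w))\<^sup>2 * (1 - (cmod (cayley z))\<^sup>2)
      \<le> (cmod (cayley z - cayley w))\<^sup>2 * (1 - (cmod (cayley (g z)))\<^sup>2)"
    using J[OF norm_cayley_less_1[OF z]] by simp
  then have "16 * ((cmod (g z - w))\<^sup>2 * Im z) / K \<le> 16 * ((cmod (z - w))\<^sup>2 * Im (g z)) / K"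
    using z w nonneg[OF z]
    by (simp add: norm_cayley_diff_power2 one_minus_norm_cayley_power2 K_def mult_ac)
  then show "(cmod (g z - w))\<^sup>2 * Im z \<le> (cmod (z - w))\<^sup>2 * Im (g z)"
    using K by (simp add: divide_le_cancel)
qed (rule w)

text \<open>The Julia inequality at infinity: horodisks there are the half-planes
  \<open>Im z > t\<close>. A point lowered by \<open>g\<close> therefore excludes infinity as a
  Denjoy-Wolff point.\<close>

lemma disk_julia_at_1_imp_Im_ge:
  assumes nonneg: "\<And>z. Im z > 0 \<Longrightarrow> Im (g z) \<ge> 0"
    and J: "\<And>u. cmod u < 1 \<Longrightarrow> (cmod ((cayley \<circ> g \<circ> inv_cayley) u - 1))\<^sup>2 * (1 - (cmod u)\<^sup>2)
      \<le> (cmod (u - 1))\<^sup>2 * (1 - (cmod ((cayley \<circ> g \<circ> inv_cayley) u))\<^sup>2)"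
    and z: "Im z > 0"
  shows "Im z \<le> Im (g z)"
proof -
  define K where "K = (cmod (g z + \<i>))\<^sup>2 * (cmod (z + \<i>))\<^sup>2"
  have K: "K > 0"
    using plus_i_nonzero[OF nonneg[OF z]] plus_i_nonzero[of z] z by (simp add: K_def)
  have "inv_cayley (cayley z) = z"
    using z by (simp add: inv_cayley_cayley closed_upper_halfplane_def)
  then have "(cmod (cayley (g z) - 1))\<^sup>2 * (1 - (cmod (cayley z))\<^sup>2)
      \<le> (cmod (cayley z - 1))\<^sup>2 * (1 - (cmod (cayley (g z)))\<^sup>2)"
    using J[OF norm_cayley_less_1[OF z]] by simp
  then have "16 * Im z / K \<le> 16 * Im (g z) / K"
    using z nonneg[OF z]
    by (simp add: norm_one_minus_cayley_power2 one_minus_norm_cayley_power2 K_def mult_ac)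
  then show ?thesis
    using K by (simp add: divide_le_cancel)
qed

text \<open>The aperture comes from
  \<open>|u - cayley w| = 2 |z - w| / (|z + \<i>| |w + \<i>|)\<close> and
  \<open>1 - |u| \<le> 1 - |u|^2 = 4 Im z / |z + \<i>|^2\<close>, after dropping a factor
  \<open>|z + \<i>| \<ge> 1\<close>.\<close>

lemma inv_cayley_stolz_region:
  assumes w: "Im w = 0" and M: "M > 1"
  shows "filterlim inv_cayley
      (at w within {z. Im z > 0 \<and> cmod (z - w) \<le> 2 * M * cmod (w + \<i>) * Im z})
      (at (cayley w) within stolz_region (cayley w) M)"
  unfolding filterlim_at
proof
  have "cayley w \<noteq> 1"
    using cayley_neq_1 w by simp
  then have "isCont inv_cayley (cayley w)"
    unfolding inv_cayley_def by (intro continuous_intros) auto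
  then have "(inv_cayley \<longlongrightarrow> inv_cayley (cayley w)) (at (cayley w) within stolz_region (cayley w) M)"
    using continuous_at_imp_continuous_at_within continuous_within by blast
  then show "(inv_cayley \<longlongrightarrow> w) (at (cayley w) within stolz_region (cayley w) M)"
    using w by (simp add: inv_cayley_cayley closed_upper_halfplane_def)
  have "Im (inv_cayley u) > 0 \<and>
      cmod (inv_cayley u - w) \<le> 2 * M * cmod (w + \<i>) * Im (inv_cayley u) \<and> inv_cayley u \<noteq> w"
    if u: "u \<in> stolz_region (cayley w) M" for u
  proof -
    define z where "z = inv_cayley u"
    have u1: "cmod u < 1" and us: "cmod (u - cayley w) < M * (1 - cmod u)"
      using u by (auto simp: stolz_region_def)
    have z: "Im z > 0"
      using inv_cayley_in_halfplane[OF u1] by (simp add: z_def)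
    have uz: "u = cayley z"
      using u1 by (auto simp: z_def cayley_inv_cayley_disk)
    have zi: "cmod (z + \<i>) \<ge> 1"
      using z abs_Im_le_cmod[of "z + \<i>"] by simp
    have wi: "cmod (w + \<i>) > 0"
      using plus_i_nonzero[of w] w by simp
    have "1 - cmod u \<le> 1 - (cmod u)\<^sup>2"
      using u1 by (simp add: power2_eq_square mult_left_le)
    then have "cmod (u - cayley w) \<le> M * (1 - (cmod u)\<^sup>2)"
      using us M by (smt (verit) mult_left_mono)
    then have "2 * cmod (z - w) / (cmod (z + \<i>) * cmod (w + \<i>)) \<le> M * (4 * Im z / (cmod (z + \<i>))\<^sup>2)"
      unfolding uz using z w
      by (simp add: one_minus_norm_cayley_power2 cayley_diff norm_divide norm_mult)
    then have "2 * cmod (z - w) / (cmod (z + \<i>) * cmod (w + \<i>)) * ((cmod (z + \<i>))\<^sup>2 * cmod (w + \<i>) / 2)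
        \<le> M * (4 * Im z / (cmod (z + \<i>))\<^sup>2) * ((cmod (z + \<i>))\<^sup>2 * cmod (w + \<i>) / 2)"
      by (rule mult_right_mono) simp
    moreover have "cmod (z + \<i>) \<noteq> 0" "cmod (w + \<i>) \<noteq> 0"
      using zi wi by linarith+
    ultimately have "cmod (z - w) * cmod (z + \<i>) \<le> 2 * M * cmod (w + \<i>) * Im z"
      by (simp add: power2_eq_square mult_ac)
    moreover have "cmod (z - w) * 1 \<le> cmod (z - w) * cmod (z + \<i>)"
      using zi by (intro mult_left_mono) auto
    ultimately show ?thesis
      using z w by (auto simp: z_def)
  qed
  then show "eventually (\<lambda>u. inv_cayley u \<in> {z. Im z > 0 \<and> cmod (z - w) \<le> 2 * M * cmod (w + \<i>) * Im z}
      \<and> inv_cayley u \<noteq> w) (at (cayley w) within stolz_region (cayley w) M)"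
    unfolding eventually_at_filter by (intro always_eventually) auto
qed

lemma cayley_conjugate_self_map:
  fixes g :: "complex \<Rightarrow> complex"
  assumes holg: "g holomorphic_on upper_halfplane"
    and nonneg: "\<And>z. Im z > 0 \<Longrightarrow> Im (g z) \<ge> 0"
  shows "(cayley \<circ> g \<circ> inv_cayley) holomorphic_on ball 0 1"
    and "(cayley \<circ> g \<circ> inv_cayley) ` ball 0 1 \<subseteq> cball 0 1"
proof -
  have "cayley holomorphic_on closed_upper_halfplane"
    unfolding cayley_def closed_upper_halfplane_def
    by (intro holomorphic_intros) (auto dest: plus_i_nonzero)
  moreover have "inv_cayley holomorphic_on ball 0 1"
    unfolding inv_cayley_def by (intro holomorphic_intros) auto
  ultimately show "(cayley \<circ> g \<circ> inv_cayley) holomorphic_on ball 0 1"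
    using inv_cayley_in_halfplane nonneg
    by (intro holomorphic_on_compose_gen[of _ _ _ upper_halfplane]
        holomorphic_on_compose_gen[OF holg, of _ closed_upper_halfplane])
      (auto simp: upper_halfplane_def closed_upper_halfplane_def)
  show "(cayley \<circ> g \<circ> inv_cayley) ` ball 0 1 \<subseteq> cball 0 1"
    using inv_cayley_in_halfplane nonneg norm_cayley_le_1 by auto
qed

text \<open>At a real \<open>w\<close>, limits in all cones pull back along
  \<open>inv_cayley\<close> to nontangential limits in the disk.\<close>

lemma julia_point_imp_denjoy_wolff:
  fixes g :: "complex \<Rightarrow> complex"
  assumes holg: "g holomorphic_on upper_halfplane"
    and nonneg: "\<And>z. Im z > 0 \<Longrightarrow> Im (g z) \<ge> 0"
    and J: "julia_point g w"
  shows "denjoy_wolff_point (cayley \<circ> g \<circ> inv_cayley) (cayley w)"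
proof (cases "Im w > 0")
  case True
  have "inv_cayley (cayley w) = w"
    using True by (simp add: inv_cayley_cayley closed_upper_halfplane_def)
  then show ?thesis
    unfolding denjoy_wolff_point_def
    using cayley_conjugate_self_map[OF holg nonneg] norm_cayley_less_1[OF True]
      julia_point_interior_fixed[OF J True] by simp
next
  case False
  then have w: "Im w = 0"
    using J by (simp add: julia_point_def)
  define F where "F = (\<lambda>M. at w within {z. Im z > 0 \<and> cmod (z - w) \<le> M * Im z})"
  obtain c :: real where c: "c \<le> 1"
    and lim: "\<And>M. M > 0 \<Longrightarrow> ((\<lambda>z. (g z - w) / (z - w)) \<longlongrightarrow> of_real c) (F M)"
    using julia_point_angular_derivative[OF holg nonneg J w] unfolding F_def by blast
  have wi: "w + \<i> \<noteq> 0"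
    using plus_i_nonzero w by simp
  have zF: "((\<lambda>z. z) \<longlongrightarrow> w) (F M)" for M
    unfolding F_def by (rule tendsto_ident_at)
  \<comment> \<open>A finite angular derivative already forces \<open>g\<close> to tend to
    \<open>w\<close> in cones.\<close>
  have gF: "(g \<longlongrightarrow> w) (F M)" if "M > 0" for M
  proof -
    have "((\<lambda>z. w + (g z - w) / (z - w) * (z - w)) \<longlongrightarrow> w + of_real c * (w - w)) (F M)"
      by (intro tendsto_intros lim that zF)
    moreover have "eventually (\<lambda>z. w + (g z - w) / (z - w) * (z - w) = g z) (F M)"
      unfolding F_def eventually_at_filter by (intro always_eventually) auto
    ultimately show ?thesis
      using tendsto_cong by fastforce
  qed
  have quot: "((\<lambda>z. (cayley (g z) - cayley w) / (cayley z - cayley w)) \<longlongrightarrow> of_real c) (F M)"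
    if "M > 0" for M
  proof -
    \<comment> \<open>The difference quotients in disk and half-plane differ by the factor
      \<open>(z + \<i>) / (g z + \<i>)\<close>, which tends to 1.\<close>
    have "((\<lambda>z. (g z - w) / (z - w) * ((z + \<i>) / (g z + \<i>))) \<longlongrightarrow>
        of_real c * ((w + \<i>) / (w + \<i>))) (F M)"
      by (intro tendsto_intros lim zF gF that wi)
    moreover have "(g z - w) / (z - w) * ((z + \<i>) / (g z + \<i>))
        = (cayley (g z) - cayley w) / (cayley z - cayley w)" if "Im z > 0" "z \<noteq> w" for z
      using that w wi plus_i_nonzero[OF nonneg[OF that(1)]] plus_i_nonzero[of z] nonneg[OF that(1)]
      by (simp add: cayley_diff divide_simps)
    then have "eventually (\<lambda>z. (g z - w) / (z - w) * ((z + \<i>) / (g z + \<i>))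
        = (cayley (g z) - cayley w) / (cayley z - cayley w)) (F M)"
      unfolding F_def eventually_at_filter by (intro always_eventually) auto
    ultimately show ?thesis
      using tendsto_cong wi by fastforce
  qed
  have gcF: "((\<lambda>z. cayley (g z)) \<longlongrightarrow> cayley w) (F M)" if "M > 0" for M
    unfolding cayley_def by (intro tendsto_intros gF that wi)
  have comp: "has_nontangential_limit (\<lambda>u. h (inv_cayley u)) (cayley w) l"
    if "\<And>M. M > 0 \<Longrightarrow> (h \<longlongrightarrow> l) (F M)" for h :: "complex \<Rightarrow> complex" and l
    unfolding has_nontangential_limit_def
  proof (intro allI impI)
    fix M :: real assume M: "M > 1"
    have "filterlim inv_cayley (F (2 * M * cmod (w + \<i>))) (at (cayley w) within stolz_region (cayley w) M)"
      unfolding F_def by (rule inv_cayley_stolz_region[OF w M])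
    then show "((\<lambda>u. h (inv_cayley u)) \<longlongrightarrow> l) (at (cayley w) within stolz_region (cayley w) M)"
      using that[of "2 * M * cmod (w + \<i>)"] M wi by (auto intro: filterlim_compose)
  qed
  have "has_nontangential_limit (cayley \<circ> g \<circ> inv_cayley) (cayley w) (cayley w)"
    using comp[OF gcF] by (simp add: o_def)
  moreover have "has_nontangential_limit
      (\<lambda>u. ((cayley \<circ> g \<circ> inv_cayley) u - cayley w) / (u - cayley w)) (cayley w) (of_real c)"
  proof -
    have "has_nontangential_limit
        (\<lambda>u. (cayley (g (inv_cayley u)) - cayley w) / (cayley (inv_cayley u) - cayley w))
        (cayley w) (of_real c)"
      by (rule comp[OF quot])
    moreover have "cayley (inv_cayley u) = u" if "u \<in> stolz_region (cayley w) M" for u M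
      using that by (intro cayley_inv_cayley_disk) (auto simp: stolz_region_def)
    ultimately show ?thesis
      unfolding has_nontangential_limit_def
      by (auto simp: eventually_at_filter elim!: Lim_transform_eventually)
  qed
  ultimately show ?thesis
    unfolding denjoy_wolff_point_def
    using cayley_conjugate_self_map[OF holg nonneg] norm_cayley_real[OF w] c by blast
qed

text \<open>The lowered point \<open>z0\<close> excludes infinity; every other Denjoy-Wolff point
  pulls back to a Julia point, and Julia points are unique.\<close>

lemma denjoy_wolff_point_iff:
  fixes g :: "complex \<Rightarrow> complex"
  assumes holg: "g holomorphic_on upper_halfplane"
    and nonneg: "\<And>z. Im z > 0 \<Longrightarrow> Im (g z) \<ge> 0"
    and z0: "Im z0 > 0" "Im (g z0) < Im z0"
    and J: "julia_point g w"
  shows "denjoy_wolff_point (cayley \<circ> g \<circ> inv_cayley) v \<longleftrightarrow> v = cayley w"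
proof
  assume DW: "denjoy_wolff_point (cayley \<circ> g \<circ> inv_cayley) v"
  have v1: "v \<noteq> 1"
  proof
    assume "v = 1"
    then have "Im z0 \<le> Im (g z0)"
      using boundary_denjoy_wolff_imp_julia[OF holg nonneg DW]
      by (intro disk_julia_at_1_imp_Im_ge[OF nonneg _ z0(1)]) auto
    then show False
      using z0 by simp
  qed
  have cv: "cayley (inv_cayley v) = v"
    by (rule cayley_inv_cayley[OF v1])
  have "julia_point g (inv_cayley v)"
  proof (cases "cmod v = 1")
    case True
    then show ?thesis
      using boundary_denjoy_wolff_imp_julia[OF holg nonneg DW True] Im_inv_cayley_unit_circle
      by (intro disk_julia_imp_julia_point[OF nonneg]) (auto simp: cv)
  next
    case False
    then have v: "cmod v < 1" "cayley (g (inv_cayley v)) = v"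
      using DW by (auto simp: denjoy_wolff_point_def)
    have Im: "Im (inv_cayley v) > 0"
      using inv_cayley_in_halfplane v(1) .
    have "inv_cayley (cayley (g (inv_cayley v))) = g (inv_cayley v)"
      using nonneg[OF Im] by (simp add: inv_cayley_cayley closed_upper_halfplane_def)
    then show ?thesis
      using v(2) by (intro fixed_imp_julia_point[OF holg nonneg Im]) auto
  qed
  moreover have "g z0 \<noteq> z0"
    using z0(2) by auto
  ultimately have "inv_cayley v = w"
    using julia_point_unique[OF holg nonneg z0(1)] J by blast
  then show "v = cayley w"
    using cv by simp
next
  assume "v = cayley w"
  then show "denjoy_wolff_point (cayley \<circ> g \<circ> inv_cayley) v"
    using julia_point_imp_denjoy_wolff[OF holg nonneg J] by simp
qed

subsection \<open>The right inverse\<close>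

text \<open>Growth of \<open>Im H\<close> on the imaginary axis stands in for the positive limit
  \<open>a\<close>. It ensures that each \<open>G \<alpha>\<close> lowers some point, hence is not
  the identity.\<close>

locale halfplane_right_inverse =
  fixes H :: "complex \<Rightarrow> complex"
  assumes holH: "H holomorphic_on upper_halfplane"
    and Im_H_le: "Im z > 0 \<Longrightarrow> Im (H z) \<le> Im z"
    and Im_H_at_top: "filterlim (\<lambda>y::real. Im (H (\<i> * of_real y))) at_top at_top"
begin

definition G :: "complex \<Rightarrow> complex \<Rightarrow> complex" where
  "G \<alpha> z = z + \<alpha> - H z"

lemma holG: "G \<alpha> holomorphic_on upper_halfplane"
  unfolding G_def by (intro holomorphic_intros holH)

lemma Im_G_ge: "Im z > 0 \<Longrightarrow> Im \<alpha> \<le> Im (G \<alpha> z)"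
  using Im_H_le[of z] by (simp add: G_def)

lemma Im_G_nonneg: "Im \<alpha> \<ge> 0 \<Longrightarrow> Im z > 0 \<Longrightarrow> Im (G \<alpha> z) \<ge> 0"
  using Im_G_ge order_trans by blast

lemma G_eq_iff: "G \<alpha> z = z \<longleftrightarrow> H z = \<alpha>"
  by (auto simp: G_def algebra_simps)

lemma ex_Im_H_greater: "\<exists>y>0. Im (H (\<i> * of_real y)) > R"
proof -
  have "eventually (\<lambda>y::real. y > 0 \<and> Im (H (\<i> * of_real y)) > R) at_top"
    using Im_H_at_top eventually_gt_at_top[of 0] unfolding filterlim_at_top_dense
    by (auto intro: eventually_conj)
  then show ?thesis
    using eventually_happens'[of "at_top :: real filter"] by auto
qed

lemma ex_Im_G_less: "\<exists>z. Im z > 0 \<and> Im (G \<alpha> z) < Im z"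
proof -
  obtain y where "y > 0" "Im (H (\<i> * of_real y)) > Im \<alpha>"
    using ex_Im_H_greater by blast
  then show ?thesis
    by (intro exI[of _ "\<i> * of_real y"]) (simp add: G_def)
qed

lemma julia_point_G_unique:
  assumes "Im \<alpha> \<ge> 0" "julia_point (G \<alpha>) w0" "julia_point (G \<alpha>) w1"
  shows "w0 = w1"
proof -
  obtain z where "Im z > 0" "Im (G \<alpha> z) < Im z"
    using ex_Im_G_less by blast
  moreover from this have "G \<alpha> z \<noteq> z"
    by auto
  ultimately show ?thesis
    using julia_point_unique[OF holG Im_G_nonneg[OF assms(1)] _ _ assms(2,3)] by blast
qed

lemma julia_point_of_H:
  assumes "Im z > 0" "Im (H z) \<ge> 0"
  shows "julia_point (G (H z)) z"
  using fixed_imp_julia_point[OF holG Im_G_nonneg[OF assms(2)] assms(1)] by (simp add: G_eq_iff)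

text \<open>Since \<open>Im (G \<alpha> z) \<ge> Im \<alpha>\<close>, the number
  \<open>Im \<alpha>\<close> serves as the \<open>\<eta>\<close> of the fixed point lemma.\<close>

lemma H_surj_halfplane:
  assumes "Im \<alpha> > 0"
  shows "\<exists>z. Im z > 0 \<and> H z = \<alpha>"
proof -
  obtain y where "y > 0" "Im (H (\<i> * of_real y)) > Im \<alpha>"
    using ex_Im_H_greater by blast
  then have "\<exists>z. Im z > 0 \<and> G \<alpha> z = z"
    using halfplane_fixed_point_exists[OF holG assms Im_G_ge, of "\<i> * of_real y"]
    by (simp add: G_def)
  then show ?thesis
    by (simp add: G_eq_iff)
qed

text \<open>At a point \<open>p = iy\<close> with \<open>Im H(p) > R\<close> the Julia inequality reads
  \<open>|G \<alpha> p - w| \<le> q |p - w|\<close> with \<open>q < 1\<close> independent of \<open>\<alpha>\<close>.\<close>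

lemma julia_points_bounded:
  "\<exists>B. \<forall>\<alpha> w. Im \<alpha> \<ge> 0 \<longrightarrow> cmod \<alpha> \<le> R \<longrightarrow> julia_point (G \<alpha>) w \<longrightarrow> cmod w \<le> B"
proof -
  obtain y where y: "y > 0" "Im (H (\<i> * of_real y)) > R"
    using ex_Im_H_greater by blast
  define p where "p = \<i> * of_real y"
  have p: "Im p = y" "cmod p = y" "Im (H p) > R"
    using y by (simp_all add: p_def norm_mult)
  \<comment> \<open>\<open>q^2 * y\<close> bounds \<open>Im (G \<alpha> p)\<close> whenever
    \<open>|\<alpha>| \<le> R\<close>; \<open>B\<close> comes from solving the final inequality for
    \<open>|w|\<close>.\<close>
  define q where "q = sqrt ((y + R - Im (H p)) / y)"
  define B where "B = (y + R + cmod (H p) + q * y) / (1 - q)"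
  have "cmod w \<le> B" if \<alpha>: "Im \<alpha> \<ge> 0" "cmod \<alpha> \<le> R" and J: "julia_point (G \<alpha>) w" for \<alpha> w
  proof -
    have "R \<ge> 0"
      using \<alpha>(2) norm_ge_zero order_trans by blast
    then have frac: "0 \<le> (y + R - Im (H p)) / y" "(y + R - Im (H p)) / y < 1"
      using y p Im_H_le[of p] by (auto simp: field_simps)
    have q: "0 \<le> q" "q < 1" "q\<^sup>2 * y = y + R - Im (H p)"
      using frac y(1) by (auto simp: q_def real_sqrt_pow2)
    have "Im (G \<alpha> p) \<le> q\<^sup>2 * y"
      using \<alpha>(2) abs_Im_le_cmod[of \<alpha>] by (simp add: q(3) G_def p)
    then have "(cmod (p - w))\<^sup>2 * Im (G \<alpha> p) \<le> (cmod (p - w))\<^sup>2 * (q\<^sup>2 * y)"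
      by (intro mult_left_mono) auto
    moreover have "(cmod (G \<alpha> p - w))\<^sup>2 * y \<le> (cmod (p - w))\<^sup>2 * Im (G \<alpha> p)"
      using julia_pointD[OF J, of p] y by (simp add: p)
    ultimately have "(cmod (G \<alpha> p - w))\<^sup>2 * y \<le> (q * cmod (p - w))\<^sup>2 * y"
      by (simp add: power_mult_distrib mult_ac)
    then have "(cmod (G \<alpha> p - w))\<^sup>2 \<le> (q * cmod (p - w))\<^sup>2"
      using y(1) by simp
    then have "cmod (G \<alpha> p - w) \<le> q * cmod (p - w)"
      by (rule power2_le_imp_le) (use q in auto)
    also have "\<dots> \<le> q * (y + cmod w)"
      using norm_triangle_ineq4[of p w] q(1) p by (intro mult_left_mono) auto
    finally have 1: "cmod (G \<alpha> p - w) \<le> q * y + q * cmod w"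
      by (simp add: algebra_simps)
    have "cmod (G \<alpha> p) \<le> y + R + cmod (H p)"
      unfolding G_def using norm_triangle_ineq4[of "p + \<alpha>" "H p"] norm_triangle_ineq[of p \<alpha>] p \<alpha>(2)
      by linarith
    then have "cmod w \<le> y + R + cmod (H p) + (q * y + q * cmod w)"
      using 1 norm_triangle_ineq4[of "G \<alpha> p" "G \<alpha> p - w"] by simp
    then have "cmod w * (1 - q) \<le> y + R + cmod (H p) + q * y"
      by (simp add: algebra_simps)
    then show ?thesis
      using q(2) by (simp add: B_def pos_le_divide_eq)
  qed
  then show ?thesis
    by blast
qed

section \<open>Existence of Julia points by compactness\<close>

text \<open>For each fixed \<open>z\<close> the condition is a non-strict inequality between
  continuous functions of \<open>(\<alpha>, w)\<close>, as \<open>G \<alpha> z\<close> is affine in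
  \<open>\<alpha>\<close>.\<close>

lemma closed_julia_graph: "closed {x. julia_point (G (fst x)) (snd x)}"
  unfolding julia_point_def G_def
  by (intro closed_Collect_conj closed_Collect_all closed_Collect_imp closed_Collect_le
      continuous_intros open_Collect_const)

lemma tendsto_shift_up: "(\<lambda>n. \<alpha> + \<i> * of_real (inverse (real (Suc n)))) \<longlonglongrightarrow> \<alpha>"
proof -
  have "(\<lambda>n. \<alpha> + \<i> * of_real (inverse (real (Suc n)))) \<longlonglongrightarrow> \<alpha> + \<i> * of_real 0"
    by (intro tendsto_intros LIMSEQ_inverse_real_of_nat)
  then show ?thesis
    by simp
qed

text \<open>Shifting \<open>\<alpha>\<close> upwards gives interior fixed points; they stay bounded,
  and a limit of a subsequence is a Julia point because the graph is closed.\<close>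

lemma julia_point_G_exists:
  assumes "Im \<alpha> \<ge> 0"
  shows "\<exists>w. julia_point (G \<alpha>) w"
proof -
  define A where "A = (\<lambda>n. \<alpha> + \<i> * of_real (inverse (real (Suc n))))"
  have A: "Im (A n) > 0" "cmod (A n) \<le> cmod \<alpha> + 1" for n
  proof -
    show "Im (A n) > 0"
      using assms by (auto simp: A_def intro!: add_nonneg_pos)
    have "cmod (\<i> * of_real (inverse (real (Suc n)))) \<le> 1"
      by (simp add: norm_mult inverse_le_1_iff del: of_real_inverse of_nat_Suc)
    then show "cmod (A n) \<le> cmod \<alpha> + 1"
      unfolding A_def using norm_triangle_ineq order_trans add_left_mono by blast
  qed
  have "\<exists>w. julia_point (G (A n)) w" for n
    using H_surj_halfplane[OF A(1)[of n]] julia_point_of_H A(1)[of n] by (metis less_imp_le)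
  then obtain W where W: "\<And>n. julia_point (G (A n)) (W n)"
    by metis
  obtain B where "\<And>\<alpha>' w. Im \<alpha>' \<ge> 0 \<Longrightarrow> cmod \<alpha>' \<le> cmod \<alpha> + 1 \<Longrightarrow> julia_point (G \<alpha>') w \<Longrightarrow> cmod w \<le> B"
    using julia_points_bounded by blast
  then have "bounded (range W)"
    using A W unfolding bounded_iff by (metis less_imp_le rangeE)
  then obtain w r where r: "strict_mono r" "(W \<circ> r) \<longlonglongrightarrow> w"
    using bounded_imp_convergent_subsequence by blast
  have "(A \<circ> r) \<longlonglongrightarrow> \<alpha>"
    using LIMSEQ_subseq_LIMSEQ[OF tendsto_shift_up r(1)] unfolding A_def .
  then have lim: "(\<lambda>n. ((A \<circ> r) n, (W \<circ> r) n)) \<longlonglongrightarrow> (\<alpha>, w)"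
    using r(2) by (rule tendsto_Pair)
  have "((A \<circ> r) n, (W \<circ> r) n) \<in> {x. julia_point (G (fst x)) (snd x)}" for n
    using W by simp
  then have "(\<alpha>, w) \<in> {x. julia_point (G (fst x)) (snd x)}"
    using closed_sequentially[OF closed_julia_graph _ lim] by blast
  then show ?thesis
    by auto
qed

section \<open>Continuity and analyticity of \<open>omega\<close>\<close>

text \<open>For \<open>Im \<alpha> \<ge> 0\<close> the choice is forced by
  \<open>julia_point_G_unique\<close>.\<close>

definition omega :: "complex \<Rightarrow> complex" where
  "omega \<alpha> = (SOME w. julia_point (G \<alpha>) w)"

lemma julia_point_omega: "Im \<alpha> \<ge> 0 \<Longrightarrow> julia_point (G \<alpha>) (omega \<alpha>)"
  unfolding omega_def using julia_point_G_exists by (rule someI_ex)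

lemma Im_omega_nonneg: "Im \<alpha> \<ge> 0 \<Longrightarrow> Im (omega \<alpha>) \<ge> 0"
  using julia_point_omega by (simp add: julia_point_def)

text \<open>Both sides are Julia points of \<open>G (H z)\<close>. Real values of \<open>H z\<close>
  are included, which the continuation across the real line relies on.\<close>

lemma omega_H: "Im z > 0 \<Longrightarrow> Im (H z) \<ge> 0 \<Longrightarrow> omega (H z) = z"
  using julia_point_G_unique julia_point_omega julia_point_of_H by blast

lemma H_omega: "Im \<alpha> \<ge> 0 \<Longrightarrow> Im (omega \<alpha>) > 0 \<Longrightarrow> H (omega \<alpha>) = \<alpha>"
  using julia_point_interior_fixed julia_point_omega G_eq_iff by blast

lemma Im_omega_pos: "Im \<alpha> > 0 \<Longrightarrow> Im (omega \<alpha>) > 0"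
  using H_surj_halfplane omega_H by (metis less_imp_le)

text \<open>On bounded pieces \<open>omega\<close> takes values in a compact disk, and by uniqueness
  its graph is a piece of the closed Julia set; a closed graph over a compact target gives
  continuity.\<close>

lemma continuous_omega: "continuous_on closed_upper_halfplane omega"
proof -
  have cont: "continuous_on (closed_upper_halfplane \<inter> cball 0 R) omega" for R
  proof -
    obtain B where B: "\<And>\<alpha> w. Im \<alpha> \<ge> 0 \<Longrightarrow> cmod \<alpha> \<le> R \<Longrightarrow> julia_point (G \<alpha>) w \<Longrightarrow> cmod w \<le> B"
      using julia_points_bounded by blast
    show ?thesis
    proof (rule continuous_from_closed_graph)
      show "compact (cball 0 B :: complex set)"
        by simp
      show "omega \<in> closed_upper_halfplane \<inter> cball 0 R \<rightarrow> cball 0 B"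
        using B julia_point_omega by (auto simp: closed_upper_halfplane_def)
      have "(\<lambda>x. (x, omega x)) ` (closed_upper_halfplane \<inter> cball 0 R)
          = {x. julia_point (G (fst x)) (snd x)} \<inter> ((closed_upper_halfplane \<inter> cball 0 R) \<times> UNIV)"
        using julia_point_omega julia_point_G_unique
        by (auto simp: closed_upper_halfplane_def image_iff)
      moreover have "closed closed_upper_halfplane"
        unfolding closed_upper_halfplane_def by (intro closed_Collect_le continuous_intros)
      ultimately show "closed ((\<lambda>x. (x, omega x)) ` (closed_upper_halfplane \<inter> cball 0 R))"
        by (auto intro!: closed_Int closed_Times closed_julia_graph)
    qed
  qed
  show ?thesis
    unfolding continuous_on_eq_continuous_within
  proof
    fix \<alpha> assume \<alpha>: "\<alpha> \<in> closed_upper_halfplane"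
    have "continuous (at \<alpha> within closed_upper_halfplane \<inter> cball 0 (cmod \<alpha> + 1)) omega"
      using cont \<alpha> by (simp add: continuous_on_eq_continuous_within)
    moreover have "at \<alpha> within closed_upper_halfplane \<inter> cball 0 (cmod \<alpha> + 1)
        = at \<alpha> within closed_upper_halfplane"
      by (rule at_within_nhd[of _ "ball 0 (cmod \<alpha> + 1)"]) auto
    ultimately show "continuous (at \<alpha> within closed_upper_halfplane) omega"
      by simp
  qed
qed

text \<open>\<open>omega\<close> inverts \<open>H\<close> on the open set \<open>S\<close> where
  \<open>H\<close> has values in the half-plane, so \<open>H\<close> is injective there and its
  inverse is holomorphic.\<close>

lemma holomorphic_omega: "omega holomorphic_on upper_halfplane"
proof -
  define S where "S = {z. z \<in> upper_halfplane \<and> H z \<in> upper_halfplane}"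
  have "open (upper_halfplane \<inter> H -` upper_halfplane)"
    using continuous_open_preimage[OF holomorphic_on_imp_continuous_on[OF holH]]
      open_upper_halfplane by blast
  then have "open S"
    by (simp add: S_def Int_def)
  have inv: "omega (H z) = z" if "z \<in> S" for z
    using that omega_H by (simp add: S_def upper_halfplane_def)
  then have "inj_on H S"
    by (metis inj_onI)
  have "H holomorphic_on S"
    by (rule holomorphic_on_subset[OF holH]) (auto simp: S_def)
  then obtain F where F: "F holomorphic_on H ` S" "\<And>z. z \<in> S \<Longrightarrow> F (H z) = z"
    using holomorphic_has_inverse \<open>open S\<close> \<open>inj_on H S\<close> by metis
  have "\<alpha> \<in> H ` S" if "\<alpha> \<in> upper_halfplane" for \<alpha>
    using that H_surj_halfplane[of \<alpha>] by (auto simp: S_def upper_halfplane_def)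
  then have "H ` S = upper_halfplane"
    by (auto simp: S_def)
  moreover have "F \<alpha> = omega \<alpha>" if "\<alpha> \<in> H ` S" for \<alpha>
    using that F(2) inv by auto
  ultimately show ?thesis
    using F(1) holomorphic_transform by metis
qed

section \<open>Expansiveness and the derivative bound\<close>

text \<open>Schwarz-Pick for \<open>G 0\<close>, whose value at \<open>omega \<gamma>\<close> is
  \<open>omega \<gamma> - \<gamma>\<close>.\<close>

lemma schwarz_pick_omega:
  assumes "Im \<alpha> > 0" "Im \<beta> > 0"
  shows "(cmod ((omega \<beta> - omega \<alpha>) - (\<beta> - \<alpha>)))\<^sup>2 * Im (omega \<beta>) * Im (omega \<alpha>)
    \<le> (cmod (omega \<beta> - omega \<alpha>))\<^sup>2 * (Im (omega \<beta>) - Im \<beta>) * (Im (omega \<alpha>) - Im \<alpha>)"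
proof -
  have eq: "G 0 (omega \<gamma>) = omega \<gamma> - \<gamma>" if "Im \<gamma> > 0" for \<gamma>
    using H_omega[of \<gamma>] Im_omega_pos[OF that] that by (simp add: G_def)
  have "G 0 (omega \<beta>) - G 0 (omega \<alpha>) = (omega \<beta> - omega \<alpha>) - (\<beta> - \<alpha>)"
    using assms by (simp add: eq algebra_simps)
  from this[symmetric] show ?thesis
    using schwarz_pick[OF holG Im_G_nonneg[of 0] Im_omega_pos[OF assms(2)] Im_omega_pos[OF assms(1)]]
      assms by (simp only: eq) simp
qed

lemma Im_omega_ge:
  assumes "Im \<alpha> > 0"
  shows "Im \<alpha> \<le> Im (omega \<alpha>)"
  using Im_H_le[OF Im_omega_pos[OF assms]] H_omega[of \<alpha>] Im_omega_pos[OF assms] assms by simp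

lemma omega_expansive_interior:
  assumes \<alpha>: "Im \<alpha> > 0" and \<beta>: "Im \<beta> > 0"
  shows "cmod (\<beta> - \<alpha>) \<le> 2 * cmod (omega \<beta> - omega \<alpha>)"
proof -
  have le: "(cmod (omega \<beta> - omega \<alpha>))\<^sup>2 * (Im (omega \<beta>) - Im \<beta>) * (Im (omega \<alpha>) - Im \<alpha>)
      \<le> (cmod (omega \<beta> - omega \<alpha>))\<^sup>2 * Im (omega \<beta>) * Im (omega \<alpha>)"
    using Im_omega_ge \<alpha> \<beta> Im_omega_pos[OF \<alpha>] Im_omega_pos[OF \<beta>] by (intro mult_mono) auto
  have "(cmod ((omega \<beta> - omega \<alpha>) - (\<beta> - \<alpha>)))\<^sup>2 \<le> (cmod (omega \<beta> - omega \<alpha>))\<^sup>2"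
    using order_trans[OF schwarz_pick_omega[OF \<alpha> \<beta>] le] Im_omega_pos[OF \<alpha>] Im_omega_pos[OF \<beta>] by simp
  then have "cmod ((omega \<beta> - omega \<alpha>) - (\<beta> - \<alpha>)) \<le> cmod (omega \<beta> - omega \<alpha>)"
    by (rule power2_le_imp_le) simp
  then show ?thesis
    using norm_triangle_ineq4[of "omega \<beta> - omega \<alpha>" "(omega \<beta> - omega \<alpha>) - (\<beta> - \<alpha>)"] by simp
qed

text \<open>The interior estimate passes to the real line by shifting both points upwards and using
  continuity.\<close>

lemma omega_expansive:
  assumes \<alpha>: "Im \<alpha> \<ge> 0" and \<beta>: "Im \<beta> \<ge> 0"
  shows "cmod (\<beta> - \<alpha>) \<le> 2 * cmod (omega \<beta> - omega \<alpha>)"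
proof -
  define A where "A = (\<lambda>\<gamma> n. \<gamma> + \<i> * of_real (inverse (real (Suc n))))"
  have A: "A \<gamma> \<longlonglongrightarrow> \<gamma>" for \<gamma>
    unfolding A_def by (rule tendsto_shift_up)
  have pos: "Im (A \<gamma> n) > 0" if "Im \<gamma> \<ge> 0" for \<gamma> n
    using that by (auto simp: A_def intro!: add_nonneg_pos)
  have lim: "(\<lambda>n. omega (A \<gamma> n)) \<longlonglongrightarrow> omega \<gamma>" if "Im \<gamma> \<ge> 0" for \<gamma>
    using that pos[OF that]
    by (intro continuous_on_tendsto_compose[OF continuous_omega A])
      (auto simp: closed_upper_halfplane_def intro!: always_eventually less_imp_le)
  show ?thesis
  proof (rule LIMSEQ_le)
    show "(\<lambda>n. cmod (A \<beta> n - A \<alpha> n)) \<longlonglongrightarrow> cmod (\<beta> - \<alpha>)"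
      by (intro tendsto_intros A)
    show "(\<lambda>n. 2 * cmod (omega (A \<beta> n) - omega (A \<alpha> n))) \<longlonglongrightarrow> 2 * cmod (omega \<beta> - omega \<alpha>)"
      by (intro tendsto_intros lim \<alpha> \<beta>)
  qed (use omega_expansive_interior pos \<alpha> \<beta> in auto)
qed

text \<open>Divide \<open>schwarz_pick_omega\<close> by \<open>|\<beta> - \<alpha>|^2\<close> and
  let \<open>\<beta>\<close> tend to \<open>\<alpha>\<close>. Since \<open>Im \<alpha> > 0\<close>
  this gives \<open>|D - 1| < |D|\<close>, which means \<open>Re D > 1/2\<close>.\<close>

lemma Re_deriv_omega:
  assumes \<alpha>: "Im \<alpha> > 0"
  shows "Re (deriv omega \<alpha>) > 1 / 2"
proof -
  define D where "D = deriv omega \<alpha>"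
  define y where "y = Im (omega \<alpha>)"
  have "(omega has_field_derivative D) (at \<alpha>)"
    unfolding D_def using holomorphic_derivI[OF holomorphic_omega open_upper_halfplane] \<alpha>
    by (simp add: upper_halfplane_def)
  then have Q: "((\<lambda>\<beta>. (omega \<beta> - omega \<alpha>) / (\<beta> - \<alpha>)) \<longlongrightarrow> D) (at \<alpha>)"
    and c: "(omega \<longlongrightarrow> omega \<alpha>) (at \<alpha>)"
    by (auto simp: has_field_derivative_iff isCont_def[symmetric] intro: DERIV_isCont)
  have "(cmod (D - 1))\<^sup>2 * y * y \<le> (cmod D)\<^sup>2 * (y - Im \<alpha>) * (y - Im \<alpha>)"
    unfolding y_def
  proof (rule tendsto_le[of "at \<alpha>"])
    have "(cmod ((omega \<beta> - omega \<alpha>) / (\<beta> - \<alpha>) - 1))\<^sup>2 * Im (omega \<beta>) * Im (omega \<alpha>)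
      \<le> (cmod ((omega \<beta> - omega \<alpha>) / (\<beta> - \<alpha>)))\<^sup>2 * (Im (omega \<beta>) - Im \<beta>) * (Im (omega \<alpha>) - Im \<alpha>)"
      if "Im \<beta> > 0" "\<beta> \<noteq> \<alpha>" for \<beta>
    proof -
      have "(omega \<beta> - omega \<alpha>) / (\<beta> - \<alpha>) - 1 = ((omega \<beta> - omega \<alpha>) - (\<beta> - \<alpha>)) / (\<beta> - \<alpha>)"
        using that(2) by (simp add: field_simps)
      then show ?thesis
        using divide_right_mono[OF schwarz_pick_omega[OF \<alpha> that(1)], of "(cmod (\<beta> - \<alpha>))\<^sup>2"]
        by (simp add: norm_divide power_divide)
    qed
    moreover have "eventually (\<lambda>\<beta>. Im \<beta> > 0 \<and> \<beta> \<noteq> \<alpha>) (at \<alpha>)"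
      using eventually_at_in_open[OF open_upper_halfplane, of \<alpha>] \<alpha>
      by (auto simp: upper_halfplane_def)
    ultimately show "eventually (\<lambda>\<beta>. (cmod ((omega \<beta> - omega \<alpha>) / (\<beta> - \<alpha>) - 1))\<^sup>2 * Im (omega \<beta>) * Im (omega \<alpha>)
      \<le> (cmod ((omega \<beta> - omega \<alpha>) / (\<beta> - \<alpha>)))\<^sup>2 * (Im (omega \<beta>) - Im \<beta>) * (Im (omega \<alpha>) - Im \<alpha>)) (at \<alpha>)"
      by (auto elim: eventually_mono)
  qed (intro tendsto_intros Q c | simp)+
  moreover have y: "0 \<le> y - Im \<alpha>" "y - Im \<alpha> < y" "y > 0"
    using Im_omega_ge[OF \<alpha>] Im_omega_pos[OF \<alpha>] \<alpha> by (auto simp: y_def)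
  moreover have "D \<noteq> 0"
  proof
    assume "D = 0"
    then show False
      using calculation by (auto simp: mult_le_0_iff)
  qed
  moreover have "(cmod D)\<^sup>2 * (y - Im \<alpha>) * (y - Im \<alpha>) < (cmod D)\<^sup>2 * y * y"
  proof -
    have "(y - Im \<alpha>) * (y - Im \<alpha>) < y * y"
      using y by (intro mult_strict_mono) auto
    then show ?thesis
      using \<open>D \<noteq> 0\<close> by (simp add: mult.assoc)
  qed
  ultimately have "(cmod (D - 1))\<^sup>2 < (cmod D)\<^sup>2"
    by (smt (verit) mult_less_cancel_right_pos)
  then show ?thesis
    unfolding cmod_power2 D_def by (simp add: power2_eq_square algebra_simps)
qed

section \<open>Analytic continuation and Denjoy-Wolff points\<close>

text \<open>A critical point of \<open>H\<close> would give \<open>G \<alpha>\<close> derivative 1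
  at an interior fixed point, and rigidity would make it the identity.\<close>

lemma deriv_H_nonzero:
  assumes \<alpha>: "Im \<alpha> \<ge> 0" and pos: "Im (omega \<alpha>) > 0"
  shows "deriv H (omega \<alpha>) \<noteq> 0"
proof
  assume d: "deriv H (omega \<alpha>) = 0"
  have "(H has_field_derivative 0) (at (omega \<alpha>))"
    using holomorphic_derivI[OF holH open_upper_halfplane, of "omega \<alpha>"] pos d
    by (simp add: upper_halfplane_def)
  then have "(G \<alpha> has_field_derivative 1) (at (omega \<alpha>))"
    unfolding G_def by (auto intro!: derivative_eq_intros)
  then have "deriv (G \<alpha>) (omega \<alpha>) = 1"
    by (rule DERIV_imp_deriv)
  then have "G \<alpha> z = z" if "Im z > 0" for z
    using halfplane_map_eq_identity[OF holG julia_point_interior_Im_pos[OF julia_point_omega[OF \<alpha>] pos]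
        pos julia_point_interior_fixed[OF julia_point_omega[OF \<alpha>] pos]] that by blast
  then show False
    using ex_Im_G_less[of \<alpha>] by auto
qed

text \<open>A local inverse of \<open>H\<close> near \<open>omega \<alpha>\<close> is the
  continuation; \<open>omega_H\<close> identifies it with \<open>omega\<close> on the closed
  half-plane.\<close>

lemma omega_continuation:
  assumes \<alpha>: "Im \<alpha> \<ge> 0" and pos: "Im (omega \<alpha>) > 0"
  shows "\<exists>r>0. \<exists>F. F holomorphic_on ball \<alpha> r \<and> (\<forall>z \<in> ball \<alpha> r \<inter> closed_upper_halfplane. F z = omega z)"
proof -
  have "omega \<alpha> \<in> upper_halfplane"
    using pos by (simp add: upper_halfplane_def)
  then obtain e where e: "e > 0" "ball (omega \<alpha>) e \<subseteq> upper_halfplane" "inj_on H (ball (omega \<alpha>) e)"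
    using has_complex_derivative_locally_injective[OF holH _ open_upper_halfplane deriv_H_nonzero[OF assms]]
    by blast
  have hol: "H holomorphic_on ball (omega \<alpha>) e"
    using holH e(2) by (rule holomorphic_on_subset)
  obtain F where F: "F holomorphic_on H ` ball (omega \<alpha>) e" "\<And>z. z \<in> ball (omega \<alpha>) e \<Longrightarrow> F (H z) = z"
    using holomorphic_has_inverse[OF hol open_ball e(3)] by metis
  have "open (H ` ball (omega \<alpha>) e)"
    by (rule open_mapping_thm3[OF hol open_ball e(3)])
  moreover have "\<alpha> \<in> H ` ball (omega \<alpha>) e"
    using H_omega[OF assms] e(1) by (metis centre_in_ball imageI)
  ultimately obtain r where r: "r > 0" "ball \<alpha> r \<subseteq> H ` ball (omega \<alpha>) e"
    using openE by blast
  have "F \<beta> = omega \<beta>" if \<beta>: "\<beta> \<in> ball \<alpha> r \<inter> closed_upper_halfplane" for \<beta>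
  proof -
    obtain z where z: "z \<in> ball (omega \<alpha>) e" "\<beta> = H z"
      using r \<beta> by blast
    then have "omega (H z) = z"
      using \<beta> e(2) by (intro omega_H) (auto simp: upper_halfplane_def closed_upper_halfplane_def)
    then show ?thesis
      using z F(2) by simp
  qed
  moreover have "F holomorphic_on ball \<alpha> r"
    using F(1) r(2) by (rule holomorphic_on_subset)
  ultimately show ?thesis
    using r(1) by blast
qed

lemma omega_denjoy_wolff:
  assumes \<alpha>: "Im \<alpha> \<ge> 0"
  shows "is_the_denjoy_wolff_point_uhp (G \<alpha>) (omega \<alpha>)"
proof -
  obtain z0 where "Im z0 > 0" "Im (G \<alpha> z0) < Im z0"
    using ex_Im_G_less by blast
  then show ?thesis
    unfolding is_the_denjoy_wolff_point_uhp_def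
    using denjoy_wolff_point_iff[OF holG Im_G_nonneg[OF \<alpha>] _ _ julia_point_omega[OF \<alpha>]]
      holG Im_G_nonneg[OF \<alpha>] Im_omega_nonneg[OF \<alpha>]
    by (auto simp: closed_upper_halfplane_def upper_halfplane_def)
qed

end

section \<open>Growth on the imaginary axis and conclusion\<close>

text \<open>For \<open>y > 0\<close>, \<open>Im (H (\<i> y))\<close> is \<open>y\<close> times the
  real part of the quotient, which tends to \<open>a > 0\<close>.\<close>

lemma filterlim_Im_at_top_imaginary_axis:
  fixes H :: "complex \<Rightarrow> complex"
  assumes lim: "((\<lambda>y::real. H (\<i> * of_real y) / (\<i> * of_real y)) \<longlongrightarrow> of_real a) at_top"
    and "a > 0"
  shows "filterlim (\<lambda>y::real. Im (H (\<i> * of_real y))) at_top at_top"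
proof -
  have "((\<lambda>y::real. Re (H (\<i> * of_real y) / (\<i> * of_real y))) \<longlongrightarrow> Re (of_real a)) at_top"
    by (rule tendsto_Re[OF lim])
  then have "((\<lambda>y::real. Re (H (\<i> * of_real y) / (\<i> * of_real y))) \<longlongrightarrow> a) at_top"
    by simp
  then have "filterlim (\<lambda>y::real. Re (H (\<i> * of_real y) / (\<i> * of_real y)) * y) at_top at_top"
    by (rule filterlim_tendsto_pos_mult_at_top[OF _ \<open>a > 0\<close> filterlim_ident])
  moreover have "eventually (\<lambda>y::real. Re (H (\<i> * of_real y) / (\<i> * of_real y)) * y
      = Im (H (\<i> * of_real y))) at_top"
    using eventually_gt_at_top[of 0]
    by eventually_elim (simp add: Re_divide power2_eq_square)
  ultimately show ?thesis
    using filterlim_cong[OF refl refl] by fastforce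
qed

theorem theorem2p1:
  fixes H :: "complex \<Rightarrow> complex" and a :: real
  assumes "H holomorphic_on upper_halfplane"
    and "\<And>z. z \<in> upper_halfplane \<Longrightarrow> Im (H z) \<le> Im z"
    and "((\<lambda>y::real. H (\<i> * of_real y) / (\<i> * of_real y)) \<longlongrightarrow> of_real a) at_top"
    and "a > 0"
  shows "(\<forall>\<alpha>\<in>upper_halfplane. \<exists>!z. z \<in> upper_halfplane \<and> H z = \<alpha>) \<and>
    (\<exists>\<omega> :: complex \<Rightarrow> complex.
      (continuous_on closed_upper_halfplane \<omega> \<and>
       \<omega> ` closed_upper_halfplane \<subseteq> closed_upper_halfplane \<and>
       \<omega> ` upper_halfplane \<subseteq> upper_halfplane \<and>
       \<omega> holomorphic_on upper_halfplane \<and>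
       (\<forall>z\<in>upper_halfplane. H (\<omega> z) = z)) \<and>
      (\<forall>\<alpha>\<in>closed_upper_halfplane.
         is_the_denjoy_wolff_point_uhp (\<lambda>z. z + \<alpha> - H z) (\<omega> \<alpha>)) \<and>
      ((\<forall>z\<in>upper_halfplane. Re (deriv \<omega> z) > 1 / 2) \<and>
       (\<forall>z1\<in>closed_upper_halfplane. \<forall>z2\<in>closed_upper_halfplane.
          norm (\<omega> z1 - \<omega> z2) \<ge> 1 / 2 * norm (z1 - z2)) \<and>
       inj_on \<omega> closed_upper_halfplane) \<and>
      (\<forall>\<alpha>::real. Im (\<omega> (of_real \<alpha>)) > 0 \<longrightarrow>
         (\<exists>r>0. \<exists>F. F holomorphic_on ball (of_real \<alpha>) r \<and>
            (\<forall>z \<in> ball (of_real \<alpha>) r \<inter> closed_upper_halfplane. F z = \<omega> z))))"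
proof -
  interpret halfplane_right_inverse H
    using assms filterlim_Im_at_top_imaginary_axis
    by unfold_locales (auto simp: upper_halfplane_def)
  have "\<exists>!z. z \<in> upper_halfplane \<and> H z = \<alpha>" if "\<alpha> \<in> upper_halfplane" for \<alpha>
  proof -
    have \<alpha>: "Im \<alpha> > 0"
      using that by (simp add: upper_halfplane_def)
    obtain z where z: "Im z > 0" "H z = \<alpha>"
      using H_surj_halfplane[OF \<alpha>] by blast
    moreover have "z' = z" if "Im z' > 0" "H z' = \<alpha>" for z'
      using omega_H[OF that(1)] omega_H[OF z(1)] that(2) z(2) \<alpha> by simp
    ultimately show ?thesis
      by (auto simp: upper_halfplane_def)
  qed
  moreover have "is_the_denjoy_wolff_point_uhp (\<lambda>z. z + \<alpha> - H z) (omega \<alpha>)"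
    if "\<alpha> \<in> closed_upper_halfplane" for \<alpha>
    using omega_denjoy_wolff[of \<alpha>] that by (simp add: closed_upper_halfplane_def G_def[abs_def])
  moreover have exp: "1 / 2 * norm (z1 - z2) \<le> norm (omega z1 - omega z2)"
    if "z1 \<in> closed_upper_halfplane" "z2 \<in> closed_upper_halfplane" for z1 z2
    using omega_expansive[of z2 z1] that by (simp add: closed_upper_halfplane_def)
  moreover have "inj_on omega closed_upper_halfplane"
    using exp by (force intro: inj_onI)
  ultimately show ?thesis
    using continuous_omega holomorphic_omega Im_omega_nonneg Im_omega_pos H_omega Re_deriv_omega
      omega_continuation
    by (intro conjI ballI exI[of _ omega] allI impI)
      (auto simp: upper_halfplane_def closed_upper_halfplane_def)
qed

end
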